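(* Let $X$ be a rearrangement invariant space on $(-1,1)$ satisfying either $1/2<\underline{\alpha}_X\le \overline{\alpha}_X<1$ or $0<\underline{\alpha}_X\le \overline{\alpha}_X<1/2$. Then the finite Hilbert transform $T_X\colon X\to X$ has no $X$-valued, continuous linear extension to any larger Banach function space; that is, there is no Banach function space $Z$ with $X\subsetneq Z\subseteq L^1$ such that $T$ maps $Z$ continuously into $X$.
   Context: We work on $(-1,1)$ with Lebesgue measure. A Banach function space (B.f.s.) is a Banach space $Z$ of (classes of) complex measurable functions with the ideal property ($f\in Z$, $|g|\le|f|$ a.e. imply $g\in Z$, $\|g\|_Z\le\|f\|_Z$) and the Fatou property. A rearrangement invariant (r.i.) space is a B.f.s. $X$ with $g\in X$, $\|g\|_X\le\|f\|_X$ whenever $f\in X$ and $g^*\le f^*$ ($f^*$ the decreasing rearrangement). For $t>0$ let $E_t f(s)=f(st)$ if $|st|\le1$, $0$ otherwise; the Boyd indices are $\underline{\alpha}_X=\sup_{0<t<1}\frac{\log\|E_{1/t}\|_{X\to X}}{\log t}$ and $\overline{\alpha}_X=\inf_{1<t<\infty}\frac{\log\|E_{1/t}\|_{X\to X}}{\log t}$. The finite Hilbert transform of $f\in L^1(-1,1)$ is $(Tf)(t)=\lim_{\varepsilon\to0^+}\frac1\pi\big(\int_{-1}^{t-\varepsilon}+\int_{t+\varepsilon}^1\big)\frac{f(x)}{x-t}\,dx$ (exists a.e.); for such $X$ it maps $X$ boundedly into $X$, denoted $T_X$. *)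

theory Defs
  imports "HOL-Analysis.Analysis"
begin

definition I11 :: "real measure" where
  "I11 = restrict_space lebesgue {-1<..<1}"

text \<open>A Banach function space is encoded by its (extended) norm functional rho:
  the space is the set of measurable functions of finite rho-norm.\<close>
definition bfs_space :: "((real \<Rightarrow> complex) \<Rightarrow> ennreal) \<Rightarrow> (real \<Rightarrow> complex) set" where
  "bfs_space \<rho> = {f \<in> borel_measurable I11. \<rho> f < \<infinity>}"

definition is_bfs :: "((real \<Rightarrow> complex) \<Rightarrow> ennreal) \<Rightarrow> bool" where
  "is_bfs \<rho> \<longleftrightarrow>
     \<comment> \<open>ideal property (also gives invariance under a.e. equality)\<close>
     (\<forall>f g. f \<in> borel_measurable I11 \<and> g \<in> borel_measurable I11 \<and>
        (AE x in I11. cmod (g x) \<le> cmod (f x)) \<longrightarrow> \<rho> g \<le> \<rho> f) \<and>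
     \<comment> \<open>norm axioms\<close>
     (\<forall>f g. f \<in> borel_measurable I11 \<and> g \<in> borel_measurable I11 \<longrightarrow>
        \<rho> (\<lambda>x. f x + g x) \<le> \<rho> f + \<rho> g) \<and>
     (\<forall>(c::complex) f. f \<in> borel_measurable I11 \<longrightarrow>
        \<rho> (\<lambda>x. c * f x) = ennreal (cmod c) * \<rho> f) \<and>
     (\<forall>f \<in> borel_measurable I11. \<rho> f = 0 \<longleftrightarrow> (AE x in I11. f x = 0)) \<and>
     \<comment> \<open>Fatou property\<close>
     (\<forall>F f. (\<forall>n. F n \<in> borel_measurable I11) \<and> f \<in> borel_measurable I11 \<and>
        (AE x in I11. incseq (\<lambda>n. cmod (F n x)) \<and> (\<lambda>n. cmod (F n x)) \<longlonglongrightarrow> cmod (f x))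
        \<longrightarrow> \<rho> f = (SUP n. \<rho> (F n))) \<and>
     \<comment> \<open>completeness (Banach space)\<close>
     (\<forall>F. (\<forall>n. F n \<in> bfs_space \<rho>) \<and>
        (\<forall>e>0. \<exists>N. \<forall>m\<ge>N. \<forall>n\<ge>N. \<rho> (\<lambda>x. F m x - F n x) < ennreal e)
        \<longrightarrow> (\<exists>f \<in> bfs_space \<rho>. (\<lambda>n. \<rho> (\<lambda>x. F n x - f x)) \<longlonglongrightarrow> 0))"

definition decr_rearr :: "(real \<Rightarrow> complex) \<Rightarrow> real \<Rightarrow> ennreal" where
  "decr_rearr f t = Inf {s::ennreal.
      emeasure I11 {x \<in> space I11. s < ennreal (cmod (f x))} \<le> ennreal t}"

definition is_ri :: "((real \<Rightarrow> complex) \<Rightarrow> ennreal) \<Rightarrow> bool" where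
  "is_ri \<rho> \<longleftrightarrow> is_bfs \<rho> \<and>
     (\<forall>f g. f \<in> borel_measurable I11 \<and> g \<in> borel_measurable I11 \<and>
        (\<forall>t\<ge>0. decr_rearr g t \<le> decr_rearr f t) \<longrightarrow> \<rho> g \<le> \<rho> f)"

definition dil :: "real \<Rightarrow> (real \<Rightarrow> complex) \<Rightarrow> real \<Rightarrow> complex" where
  "dil t f s = (if \<bar>s * t\<bar> \<le> 1 then f (s * t) else 0)"

definition dil_norm :: "((real \<Rightarrow> complex) \<Rightarrow> ennreal) \<Rightarrow> real \<Rightarrow> ennreal" where
  "dil_norm \<rho> t = (SUP f \<in> {f \<in> bfs_space \<rho>. \<rho> f \<le> 1}. \<rho> (dil t f))"

definition lower_boyd :: "((real \<Rightarrow> complex) \<Rightarrow> ennreal) \<Rightarrow> real" where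
  "lower_boyd \<rho> = (SUP t \<in> {0<..<1}. ln (enn2real (dil_norm \<rho> (1 / t))) / ln t)"

definition upper_boyd :: "((real \<Rightarrow> complex) \<Rightarrow> ennreal) \<Rightarrow> real" where
  "upper_boyd \<rho> = (INF t \<in> {1<..}. ln (enn2real (dil_norm \<rho> (1 / t))) / ln t)"

definition L1_space :: "(real \<Rightarrow> complex) set" where
  "L1_space = {f \<in> borel_measurable I11. integrable I11 f}"

definition fht :: "(real \<Rightarrow> complex) \<Rightarrow> real \<Rightarrow> complex" where
  "fht f t = Lim (at_right 0) (\<lambda>\<epsilon>::real. complex_of_real (1 / pi) *
      (LINT x:({-1<..<1} - {t - \<epsilon> .. t + \<epsilon>})|lebesgue. f x / complex_of_real (x - t)))"

end

theory Submission
  imports Defs "HOL-Real_Asymp.Real_Asymp"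
begin

text \<open>If \<open>T\<close> maps \<open>Z\<close> boundedly into \<open>X\<close>, then \<open>Z \<subseteq> X\<close>. Multiplication by \<open>cos (j t)\<close> and \<open>sin (j t)\<close> does not increase the norm of \<open>Z\<close>
  or \<open>X\<close>, and \<open>cos (j x) T (sin (j \<cdot>) s)(x) - sin (j x) T (cos (j \<cdot>) s)(x)\<close> is the integral of \<open>s\<close>
  against the nonsingular kernel \<open>sin (j (t - x)) / (\<pi> (t - x))\<close>. Averaging over \<open>j \<le> M\<close> gives
  a nonnegative kernel concentrated at scale \<open>1/M\<close>, so for simple \<open>s \<ge> 0\<close> the averages eventually exceed
  \<open>s / (8 \<pi>)\<close> almost everywhere. The Fatou property yields \<open>\<parallel>s\<parallel>\<^sub>X \<le> const \<parallel>s\<parallel>\<^sub>Z\<close>, and then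
  the same bound for all of \<open>Z\<close>.

  The principal value must exist almost everywhere for indicators of measurable sets. This follows
  from a maximal inequality, proved with the \<open>L\<^sup>2\<close> bound for the conjugate Poisson kernel and
  the Vitali covering lemma.\<close>

subsection \<open>Conjugate Poisson integrals\<close>

text \<open>\<open>fht\<close> is a \<open>Lim\<close>, which carries no information where the
  truncated integrals diverge. The singular parts of the transforms of
  \<open>sin (j t) * s t\<close> and \<open>cos (j t) * s t\<close> thus cancel only at points where
  the principal value of \<open>s\<close> is known to exist; testing on simple functions reduces
  this existence to indicators.

  For indicators the gain lies in the factor \<open>measure lborel B\<close> of the maximal
  inequality: it makes the exceptional set small when \<open>B\<close> is a thin remainder
  \<open>U - A\<close>.

  A single kernel \<open>sin (j * u) / u\<close> with \<open>j \<ge> 2\<close> changes sign on |u| <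
  2 and gives no lower bound. Summed over j \<le> M with the last term halved, the sines add up to
  (1 - cos (M u)) cot (u/2) / 2, which never has the sign opposite to u for |u| < pi, and two points
  of (-1,1) differ by less than 2. After division by \<open>pi * M\<close> the kernel is at least M
  / (4 pi) on a window of length 1/M to the right of x, where the mean of \<open>s\<close> is
  eventually at least s(x)/2; the product of these three factors is s(x) / (8 pi).\<close>

lemma lborel_integral_FTC:
  fixes f F :: "real \<Rightarrow> real"
  assumes "integrable lborel f" "\<And>x. DERIV F x :> f x" "\<And>x. isCont f x"
    "(F \<longlongrightarrow> A) at_bot" "(F \<longlongrightarrow> B) at_top"
  shows "(LINT x|lborel. f x) = B - A"
proof -
  have U: "einterval (-\<infinity>) \<infinity> = UNIV" by (auto simp: einterval_def)
  have "(LBINT x=-\<infinity>..\<infinity>. f x) = B - A"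
    by (rule interval_integral_FTC_integrable[where F=F])
      (use assms in \<open>auto simp: U set_integrable_def ereal_tendsto_simps has_real_derivative_iff_has_vector_derivative[symmetric]\<close>)
  thus ?thesis by (simp add: interval_lebesgue_integral_def U set_lebesgue_integral_def)
qed

lemma poisson_kernel_integral:
  fixes d t :: real
  assumes "d > 0"
  shows "integrable lborel (\<lambda>y. d / ((t - y)\<^sup>2 + d\<^sup>2))"
    and "(LINT y|lborel. d / ((t - y)\<^sup>2 + d\<^sup>2)) = pi"
proof -
  let ?f = "\<lambda>y. d / ((t - y)\<^sup>2 + d\<^sup>2)" and ?F = "\<lambda>y. arctan ((y - t) / d)"
  have pos: "(t - y)\<^sup>2 + d\<^sup>2 > 0" for y using assms by (simp add: add_nonneg_pos)
  have D: "DERIV ?F y :> ?f y" for y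
  proof -
    have "d * d + (y - t) * (y - t) > 0" using assms by (simp add: add_pos_nonneg)
    thus ?thesis using assms pos[of y]
      by (auto intro!: derivative_eq_intros simp: power2_eq_square field_simps)
  qed
  have C: "isCont ?f y" for y using pos[of y] by (auto intro!: continuous_intros)
  have U: "einterval (-\<infinity>) \<infinity> = UNIV" by (auto simp: einterval_def)
  have lim: "(?F \<longlongrightarrow> -(pi/2)) at_bot" "(?F \<longlongrightarrow> pi/2) at_top" using assms by real_asymp+
  have "set_integrable lborel (einterval (-\<infinity>) \<infinity>) ?f" "(LBINT x=-\<infinity>..\<infinity>. ?f x) = pi/2 - (-(pi/2))"
    by (rule interval_integral_FTC_nonneg[where F="?F"]; use D C lim assms in \<open>auto simp: ereal_tendsto_simps\<close>)+
  thus "integrable lborel ?f" "(LINT y|lborel. ?f y) = pi"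
    by (auto simp: interval_lebesgue_integral_def U set_lebesgue_integral_def set_integrable_def)
qed

text \<open>By the arithmetic-geometric mean inequality each product is at most the mean of two
  squares, and each square is at most a Poisson kernel divided by d, with integral pi/d. The bound
  is uniform in a and b, so it survives integration over pairs of points of B.\<close>

lemma cross_kernel_integrable:
  fixes a b d :: real
  assumes d: "d > 0"
  shows "integrable lborel (\<lambda>y. ((a - y) / ((a - y)\<^sup>2 + d\<^sup>2)) * ((b - y) / ((b - y)\<^sup>2 + d\<^sup>2)))" (is "integrable _ ?q")
    and "integrable lborel (\<lambda>y. (d / ((a - y)\<^sup>2 + d\<^sup>2)) * (d / ((b - y)\<^sup>2 + d\<^sup>2)))" (is "integrable _ ?p")
    and "(LINT y|lborel. \<bar>((a - y) / ((a - y)\<^sup>2 + d\<^sup>2)) * ((b - y) / ((b - y)\<^sup>2 + d\<^sup>2))\<bar>) \<le> pi / d"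
    and "(LINT y|lborel. \<bar>(d / ((a - y)\<^sup>2 + d\<^sup>2)) * (d / ((b - y)\<^sup>2 + d\<^sup>2))\<bar>) \<le> pi / d"
proof -
  let ?A = "\<lambda>a y. (a - y)\<^sup>2 + d\<^sup>2"
  let ?g = "\<lambda>y. (1/(2*d)) * (d / ?A a y + d / ?A b y)"
  have pos: "?A a y > 0" for a y using assms by (simp add: add_nonneg_pos)
  have g: "integrable lborel ?g" using poisson_kernel_integral(1)[OF d] by (intro integrable_mult_right Bochner_Integration.integrable_add)
  have gi: "(LINT y|lborel. ?g y) = pi / d"
    using poisson_kernel_integral[OF d] d by (subst integral_mult_right_zero, subst Bochner_Integration.integral_add) auto
  have q1: "((c - y) / ?A c y)\<^sup>2 \<le> 1 / ?A c y" "(d / ?A c y)\<^sup>2 \<le> 1 / ?A c y" for c y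
    using pos[of c y] by (auto simp: power_divide divide_simps power2_eq_square)
  have am: "\<bar>x * z\<bar> \<le> (X + Z) / 2" if "x\<^sup>2 \<le> X" "z\<^sup>2 \<le> Z" for x z X Z :: real
    using sum_squares_bound[of "\<bar>x\<bar>" "\<bar>z\<bar>"] that by (simp add: abs_mult)
  have g': "?g y = (1 / ?A a y + 1 / ?A b y) / 2" for y
  proof -
    have "(1 / (2 * d)) * (d * X + d * Y) = (X + Y) / 2" for X Y using d by (simp add: field_simps)
    from this[of "1 / ?A a y" "1 / ?A b y"] show ?thesis by simp
  qed
  have bq: "\<bar>?q y\<bar> \<le> ?g y" for y
    unfolding g' by (intro am q1)
  have bp: "\<bar>?p y\<bar> \<le> ?g y" for y
    unfolding g' by (intro am q1)
  show q: "integrable lborel ?q" by (rule Bochner_Integration.integrable_bound[OF g]) (auto simp only: real_norm_def intro!: AE_I2 order_trans[OF bq abs_ge_self], measurable)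
  show p: "integrable lborel ?p" by (rule Bochner_Integration.integrable_bound[OF g]) (auto simp only: real_norm_def intro!: AE_I2 order_trans[OF bp abs_ge_self], measurable)
  show "(LINT y|lborel. \<bar>?q y\<bar>) \<le> pi / d" unfolding gi[symmetric] by (intro integral_mono integrable_abs q g bq)
  show "(LINT y|lborel. \<bar>?p y\<bar>) \<le> pi / d" unfolding gi[symmetric] by (intro integral_mono integrable_abs p g bp)
qed

text \<open>Real part of \<open>\<integral> dy / ((a - y - i d) (b - y - i d)) = 0\<close>: both poles lie in the same half plane.\<close>
lemma cross_kernel_integral_eq:
  fixes a b d :: real
  assumes d: "d > 0"
  shows "(LINT y|lborel. ((a - y) / ((a - y)\<^sup>2 + d\<^sup>2)) * ((b - y) / ((b - y)\<^sup>2 + d\<^sup>2)))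
    = (LINT y|lborel. (d / ((a - y)\<^sup>2 + d\<^sup>2)) * (d / ((b - y)\<^sup>2 + d\<^sup>2)))" (is "integral\<^sup>L _ ?q = integral\<^sup>L _ ?p")
proof -
  let ?A = "\<lambda>a y. (a - y)\<^sup>2 + d\<^sup>2"
  have pos: "?A a y > 0" for a y using assms by (simp add: add_nonneg_pos)
  note nz = less_imp_neq[OF pos, symmetric]
  note i = cross_kernel_integrable(1,2)[OF d, of a b]
  let ?f = "\<lambda>y. ?q y - ?p y"
  have c: "isCont ?f y" for y using nz by (auto intro!: continuous_intros)
  have "(LINT y|lborel. ?f y) = 0 - 0"
  \<comment> \<open>For a \<noteq> b the antiderivative is the difference quotient, in the centre,
    of \<open>ln ((a - y)\<^sup>2 + d\<^sup>2) / 2\<close>. It degenerates at a = b, where its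
    limit, the derivative in a, takes over.\<close>
  proof (cases "a = b")
    case True
    let ?F = "\<lambda>y. (a - y) / ?A a y"
    show ?thesis
    proof (rule lborel_integral_FTC[where F="?F"])
      show "DERIV ?F y :> ?f y" for y
      proof -
        have "DERIV ?F y :> (2 * (a - y) * (a - y) - ?A a y) / (?A a y * ?A a y)"
          using nz[of a y] by (auto intro!: derivative_eq_intros simp: algebra_simps)
        also have "(2 * (a - y) * (a - y) - ?A a y) / (?A a y * ?A a y) = ((a - y) * (a - y) - d * d) / (?A a y * ?A a y)"
          by (simp add: power2_eq_square)
        also have "\<dots> = ?f y" unfolding True[symmetric]
          by (subst diff_divide_distrib) (simp only: times_divide_times_eq)
        finally show ?thesis .
      qed
      show "(?F \<longlongrightarrow> 0) at_bot" "(?F \<longlongrightarrow> 0) at_top" by real_asymp+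
    qed (use i c in auto)
  next
    case False
    let ?F = "\<lambda>y. (ln (?A a y) - ln (?A b y)) / (2 * (a - b))"
    show ?thesis
    proof (rule lborel_integral_FTC[where F="?F"])
      show "DERIV ?F y :> ?f y" for y
      proof -
        have "DERIV ?F y :> (2 * (y - a) / ?A a y - 2 * (y - b) / ?A b y) / (2 * (a - b))"
        proof -
          have "DERIV (\<lambda>y. ln (?A c y)) y :> 2 * (y - c) / ?A c y" for c
            using pos[of c y] by (auto intro!: derivative_eq_intros simp: field_simps)
          thus ?thesis by (intro DERIV_cdivide DERIV_diff)
        qed
        also have "2 * (y - a) / ?A a y - 2 * (y - b) / ?A b y = 2 * (a - b) * ?f y"
        proof -
          have "2 * (y - a) / ?A a y - 2 * (y - b) / ?A b y
              = (2 * (y - a) * ?A b y - 2 * (y - b) * ?A a y) / (?A a y * ?A b y)"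
            using nz[of a y] nz[of b y] by (subst diff_frac_eq) auto
          also have "2 * (y - a) * ?A b y - 2 * (y - b) * ?A a y = 2 * (a - b) * ((a - y) * (b - y) - d * d)"
            by (simp add: power2_eq_square algebra_simps)
          also have "\<dots> / (?A a y * ?A b y) = 2 * (a - b) * ?f y"
            unfolding times_divide_times_eq diff_divide_distrib[symmetric] by simp
          finally show ?thesis .
        qed
        finally show ?thesis using False by simp
      qed
      have "((\<lambda>y. ln (?A a y) - ln (?A b y)) \<longlongrightarrow> 0) at_bot" "((\<lambda>y. ln (?A a y) - ln (?A b y)) \<longlongrightarrow> 0) at_top"
        by real_asymp+
      from tendsto_divide_zero[OF this(1)] tendsto_divide_zero[OF this(2)] show "(?F \<longlongrightarrow> 0) at_bot" "(?F \<longlongrightarrow> 0) at_top" by auto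
    qed (use i c in auto)
  qed
  thus ?thesis using i by simp
qed

text \<open>The square of an integral against M is a double integral over M x M, which Fubini
  exchanges with the integration in y. Integrability on the line is asked of products of two
  translates because the conjugate kernel decays only like 1/s and is not integrable there by
  itself.\<close>

lemma convolution_square_integral:
  fixes M :: "real measure" and k :: "real \<Rightarrow> real"
  assumes M: "finite_measure M" "sets M = sets borel" and k[measurable]: "k \<in> borel_measurable borel"
    and bd: "\<And>t. \<bar>k t\<bar> \<le> c"
    and int: "\<And>a b. integrable lborel (\<lambda>y. k (a - y) * k (b - y))"
    and C: "\<And>a b. (LINT y|lborel. \<bar>k (a - y) * k (b - y)\<bar>) \<le> C"
  shows "integrable lborel (\<lambda>y. (LINT t|M. k (t - y))\<^sup>2)"
    and "(LINT y|lborel. (LINT t|M. k (t - y))\<^sup>2)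
      = (LINT z|(M \<Otimes>\<^sub>M M). LINT y|lborel. k (fst z - y) * k (snd z - y))"
proof -
  interpret finite_measure M by fact
  interpret MM: pair_sigma_finite M M ..
  let ?N = "M \<Otimes>\<^sub>M M"
  interpret N: finite_measure ?N by (rule finite_measure_pair_measure) (rule M(1))+
  interpret P: pair_sigma_finite ?N lborel ..
  note M(2)[measurable_cong]
  let ?h = "\<lambda>z y. k (fst z - y) * k (snd z - y)"
  have h[measurable]: "case_prod ?h \<in> borel_measurable (?N \<Otimes>\<^sub>M lborel)" by measurable
  have H: "integrable (?N \<Otimes>\<^sub>M lborel) (case_prod ?h)"
  proof (rule P.Fubini_integrable)
    show "integrable ?N (\<lambda>x. LINT y|lborel. norm (case_prod ?h (x, y)))"
      by (rule N.integrable_const_bound[where B=C]) (use C in auto)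
  qed (use int in auto)
  have sq: "(LINT z|?N. ?h z y) = (LINT t|M. k (t - y))\<^sup>2" for y
  proof -
    have "integrable ?N (\<lambda>z. ?h z y)"
      by (rule N.integrable_const_bound[where B="c * c"]) (use bd abs_ge_zero[THEN order_trans, OF bd] in \<open>auto simp: abs_mult intro!: mult_mono\<close>)
    from MM.integral_fst'[OF this] show ?thesis by (simp add: power2_eq_square)
  qed
  show "integrable lborel (\<lambda>y. (LINT t|M. k (t - y))\<^sup>2)" using P.integrable_snd[OF H] by (simp add: sq)
  show "(LINT y|lborel. (LINT t|M. k (t - y))\<^sup>2) = (LINT z|?N. LINT y|lborel. ?h z y)"
    using P.Fubini_integral[OF H] by (simp add: sq)
qed

lemma conjugate_kernel_bound:
  fixes s d :: real
  assumes d: "d > 0"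
  shows "\<bar>s / (s\<^sup>2 + d\<^sup>2)\<bar> \<le> 1 / d"
proof -
  have "0 \<le> \<bar>s\<bar> * d" using d by simp
  moreover have "2 * (\<bar>s\<bar> * d) \<le> s\<^sup>2 + d\<^sup>2" using sum_squares_bound[of "\<bar>s\<bar>" d] by (simp add: mult.assoc)
  ultimately have "\<bar>s\<bar> * d \<le> s\<^sup>2 + d\<^sup>2" by linarith
  thus ?thesis using d by (simp add: abs_div divide_simps add_nonneg_pos)
qed

text \<open>The conjugate Poisson integral has the same \<open>L\<^sup>2\<close> norm as the Poisson integral, which takes
  values in \<open>[0, \<pi>]\<close>.\<close>
lemma conjugate_poisson_L2:
  fixes B :: "real set" and d :: real
  assumes B[measurable]: "B \<in> sets borel" "emeasure lborel B < \<infinity>" and d: "d > 0"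
  shows "integrable lborel (\<lambda>y. (LINT t:B|lborel. (t - y) / ((t - y)\<^sup>2 + d\<^sup>2))\<^sup>2)" (is "integrable _ (\<lambda>y. (?F y)\<^sup>2)")
    and "(LINT y|lborel. (LINT t:B|lborel. (t - y) / ((t - y)\<^sup>2 + d\<^sup>2))\<^sup>2) \<le> pi\<^sup>2 * measure lborel B"
proof -
  \<comment> \<open>As integrals against this finite measure, integrals over B take the form to
    which the double integral formula applies, for both kernels alike.\<close>
  define M where "M = density lborel (\<lambda>x. ennreal (indicator B x))"
  have M: "finite_measure M" "sets M = sets borel"
    unfolding M_def using B by (auto intro!: finite_measureI simp: emeasure_density ennreal_indicator less_top)
  interpret finite_measure M by fact
  note M(2)[measurable_cong]
  have LM: "(LINT t|M. f t) = (LINT t:B|lborel. f t)" if "f \<in> borel_measurable borel" for f :: "real \<Rightarrow> real"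
    unfolding M_def using that by (subst integral_density) (auto simp: set_lebesgue_integral_def)
  have mM: "measure M (space M) = measure lborel B"
    unfolding M_def measure_def by (simp add: emeasure_density ennreal_indicator)
  let ?q = "\<lambda>s. s / (s\<^sup>2 + d\<^sup>2)" and ?p = "\<lambda>s. d / (s\<^sup>2 + d\<^sup>2)"
  have pos: "s\<^sup>2 + d\<^sup>2 > 0" for s using d by (simp add: add_nonneg_pos)
  have pb: "\<bar>?p s\<bar> \<le> 1 / d" for s using pos[of s] d by (simp add: abs_div divide_simps power2_eq_square)
  have [measurable]: "?q \<in> borel_measurable borel" "?p \<in> borel_measurable borel" by measurable
  note Q = convolution_square_integral[OF M \<open>?q \<in> borel_measurable borel\<close> conjugate_kernel_bound[OF d] cross_kernel_integrable(1,3)[OF d]]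
  note P = convolution_square_integral[OF M \<open>?p \<in> borel_measurable borel\<close> pb cross_kernel_integrable(2,4)[OF d]]
  have qM: "(LINT t|M. ?q (t - y)) = ?F y" for y by (rule LM) measurable
  show "integrable lborel (\<lambda>y. (?F y)\<^sup>2)" using Q(1) by (simp add: qM)
  let ?P = "\<lambda>y. LINT t|M. ?p (t - y)"
  have P0: "0 \<le> ?P y" for y by (rule integral_nonneg_AE) (use d in auto)
  have Ppi: "?P y \<le> pi" for y
  proof -
    have i: "integrable lborel (\<lambda>t. ?p (t - y))" "(LINT t|lborel. ?p (t - y)) = pi"
      using poisson_kernel_integral[OF d, of y] by (simp_all add: power2_commute)
    have "?P y = (LINT t:B|lborel. ?p (t - y))" by (rule LM) measurable
    also have "\<dots> \<le> (LINT t|lborel. ?p (t - y))" unfolding set_lebesgue_integral_def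
      by (rule integral_mono) (use i d in \<open>auto simp: indicator_def intro!: Bochner_Integration.integrable_bound[OF i(1)]\<close>)
    finally show ?thesis using i by simp
  qed
  interpret MP: pair_sigma_finite M lborel ..
  have I: "integrable (M \<Otimes>\<^sub>M lborel) (\<lambda>(t, y). ?p (t - y))"
    by (rule MP.Fubini_integrable) (use poisson_kernel_integral[OF d] d in auto)
  have "(LINT y|lborel. (?F y)\<^sup>2) = (LINT y|lborel. (?P y)\<^sup>2)"
    unfolding qM[symmetric] Q(2) P(2) cross_kernel_integral_eq[OF d] ..
  \<comment> \<open>Since P takes values in [0, pi], its square is at most pi P. This makes the
    bound linear in P, so that Fubini and the total mass pi of the Poisson kernel evaluate
    it.\<close>
  also have "\<dots> \<le> (LINT y|lborel. pi * ?P y)"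
    using P(1) MP.integrable_snd[OF I] P0 Ppi
    by (intro integral_mono) (auto simp: power2_eq_square intro!: mult_right_mono)
  also have "\<dots> = pi * (LINT t|M. LINT y|lborel. ?p (t - y))" using MP.Fubini_integral[OF I] by simp
  also have "\<dots> = pi\<^sup>2 * measure lborel B" using poisson_kernel_integral(2)[OF d] mM by (simp add: power2_eq_square)
  finally show "(LINT y|lborel. (?F y)\<^sup>2) \<le> pi\<^sup>2 * measure lborel B" .
qed

subsection \<open>The maximal truncated transform\<close>

text \<open>The difference of the two values has numerator
  \<open>(s' - s) * (d\<^sup>2 - s * s')\<close>. The condition on the product treats both
  decreasing branches at once, to the right of d and to the left of -d.\<close>

lemma conjugate_kernel_antimono:
  fixes s s' d :: real
  assumes "s \<le> s'" "d\<^sup>2 \<le> s * s'" "d > 0"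
  shows "s' / (s'\<^sup>2 + d\<^sup>2) \<le> s / (s\<^sup>2 + d\<^sup>2)"
proof -
  have "(s' - s) * (d\<^sup>2 - s * s') \<le> 0" using assms by (simp add: mult_nonneg_nonpos)
  hence "s' * (s\<^sup>2 + d\<^sup>2) \<le> s * (s'\<^sup>2 + d\<^sup>2)" by (simp add: algebra_simps power2_eq_square)
  moreover have "s\<^sup>2 + d\<^sup>2 > 0" "s'\<^sup>2 + d\<^sup>2 > 0" using assms by (simp_all add: add_nonneg_pos)
  ultimately show ?thesis by (simp add: divide_simps mult.commute)
qed

lemma set_integrable_bounded:
  fixes f :: "'a \<Rightarrow> real"
  assumes [measurable]: "A \<in> sets M" "f \<in> borel_measurable M" and "emeasure M A < \<infinity>" "\<And>x. x \<in> A \<Longrightarrow> \<bar>f x\<bar> \<le> c"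
  shows "set_integrable M A f"
  unfolding set_integrable_def
proof (rule Bochner_Integration.integrable_bound)
  show "integrable M (\<lambda>x. c * indicator A x)" using assms by (simp add: less_top)
qed (use assms in \<open>auto simp: indicator_def intro!: AE_I2 intro: order_trans[OF _ abs_ge_self]\<close>)

text \<open>The contribution of \<open>B\<close> outside the interval is monotone in \<open>y\<close>, so it stays large on one half of the
  interval; there the full integral or the contribution of \<open>B\<close> inside the interval is large.\<close>
lemma truncated_hilbert_local:
  fixes B :: "real set" and d :: real
  assumes B[measurable]: "B \<in> sets borel" and fin: "emeasure lborel B < \<infinity>" and d: "0 < d" "d < e / 2" and l: "0 < l"
    and T: "\<bar>LINT t:(B - {x-e..x+e})|lborel. (t - x) / ((t - x)\<^sup>2 + d\<^sup>2)\<bar> > l"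
  shows "l\<^sup>2 * e / 4 \<le> (LINT y:{x-e..x+e}|lborel.
     ((LINT t:B|lborel. (t - y) / ((t - y)\<^sup>2 + d\<^sup>2))\<^sup>2)) + pi\<^sup>2 * measure lborel (B \<inter> {x-e..x+e})"
proof -
  let ?k = "\<lambda>s. s / (s\<^sup>2 + d\<^sup>2)" and ?I = "{x-e..x+e}"
  let ?F = "\<lambda>A y. LINT t:A|lborel. ?k (t - y)"
  have e: "e > 0" using d by simp
  have fin': "emeasure lborel (B \<inter> ?I) < \<infinity>" "emeasure lborel (B - ?I) < \<infinity>"
    using fin by (auto intro: le_less_trans[OF emeasure_mono])
  have int: "set_integrable lborel A (\<lambda>t. ?k (t - y))" if "A \<in> sets borel" "emeasure lborel A < \<infinity>" for A y
    using that conjugate_kernel_bound[OF d(1)] by (intro set_integrable_bounded[where c="1/d"]) auto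
  have split: "?F B y = ?F (B \<inter> ?I) y + ?F (B - ?I) y" for y
  proof -
    have "B = (B \<inter> ?I) \<union> (B - ?I)" by auto
    moreover have "?F ((B \<inter> ?I) \<union> (B - ?I)) y = ?F (B \<inter> ?I) y + ?F (B - ?I) y"
      by (rule set_integral_Un) (use int fin' in auto)
    ultimately show ?thesis by simp
  qed
  \<comment> \<open>For t outside the interval, x and y lie on the same side of t, both at distance
    more than e/2 > d from it.\<close>
  have prod: "d\<^sup>2 \<le> (t - y) * (t - x)" if "t \<in> B - ?I" "\<bar>y - x\<bar> \<le> e / 2" for t y
  proof -
    have "e / 2 < \<bar>t - y\<bar>" "e / 2 < \<bar>t - x\<bar>" using that e by (auto simp: abs_if split: if_splits)
    hence "d * d \<le> \<bar>t - y\<bar> * \<bar>t - x\<bar>" using d by (intro mult_mono) auto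
    also have "\<dots> = (t - y) * (t - x)"
    proof (cases "t > x")
      case True thus ?thesis using that e by (auto simp: abs_if)
    next
      case False
      hence "t - y < 0" "t - x < 0" using that e by (auto simp: abs_if split: if_splits)
      thus ?thesis by (simp add: abs_if algebra_simps)
    qed
    finally show ?thesis by (simp add: power2_eq_square)
  qed
  \<comment> \<open>The far part increases with y, so a value above l persists to the right of x and
    a value below -l to the left. J stops at distance e/2 from x, as far as the product condition is
    secured. Its length e/2 times the lower bound l^2/2 for the integrand is the l^2 e/4 of the
    claim.\<close>
  obtain J where J: "J \<in> sets borel" "measure lborel J = e / 2" "emeasure lborel J < \<infinity>" "J \<subseteq> ?I" "\<And>y. y \<in> J \<Longrightarrow> \<bar>?F (B - ?I) y\<bar> \<ge> l"
  proof (cases "?F (B - ?I) x > l")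
    case True
    have "?F (B - ?I) y \<ge> ?F (B - ?I) x" if "y \<in> {x..x+e/2}" for y
      using that prod[of _ y] d by (intro set_integral_mono int fin' conjugate_kernel_antimono) auto
    with True have "\<bar>?F (B - ?I) y\<bar> \<ge> l" if "y \<in> {x..x+e/2}" for y using that by fastforce
    thus ?thesis using e by (intro that[of "{x..x+e/2}"]) auto
  next
    case False
    with T have F: "?F (B - ?I) x < - l" by linarith
    have "?F (B - ?I) y \<le> ?F (B - ?I) x" if "y \<in> {x-e/2..x}" for y
      using that prod[of _ y] d by (intro set_integral_mono int fin' conjugate_kernel_antimono) (auto simp: mult.commute)
    with F have "\<bar>?F (B - ?I) y\<bar> \<ge> l" if "y \<in> {x-e/2..x}" for y using that by fastforce
    thus ?thesis using e by (intro that[of "{x-e/2..x}"]) auto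
  qed
  have sq: "l\<^sup>2 / 2 \<le> u\<^sup>2 + v\<^sup>2" if "l \<le> \<bar>u - v\<bar>" for u v :: real
  proof -
    have "l\<^sup>2 \<le> \<bar>u - v\<bar>\<^sup>2" using l that by (intro power_mono) auto
    also have "\<dots> \<le> \<bar>u - v\<bar>\<^sup>2 + (u + v)\<^sup>2" by simp
    also have "\<dots> = 2 * (u\<^sup>2 + v\<^sup>2)"
      unfolding power2_abs by (simp add: power2_eq_square algebra_simps)
    finally show ?thesis by simp
  qed
  have pw: "l\<^sup>2 / 2 \<le> (?F B y)\<^sup>2 + (?F (B \<inter> ?I) y)\<^sup>2" if "y \<in> J" for y
  proof (rule sq)
    have "?F B y - ?F (B \<inter> ?I) y = ?F (B - ?I) y" using split[of y] by linarith
    thus "l \<le> \<bar>?F B y - ?F (B \<inter> ?I) y\<bar>" using J(5)[OF that] by (simp only:)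
  qed
  note i1 = conjugate_poisson_L2[OF B fin d(1)]
  \<comment> \<open>Applying the L2 bound to the near part alone makes it cost only pi^2 times the
    measure of B inside the interval, a quantity that can be summed over disjoint intervals.\<close>
  have "B \<inter> ?I \<in> sets borel" by measurable
  note i2 = conjugate_poisson_L2[OF this fin'(1) d(1)]
  let ?h = "\<lambda>y. indicator ?I y *\<^sub>R (?F B y)\<^sup>2 + (?F (B \<inter> ?I) y)\<^sup>2"
  have s: "integrable lborel (\<lambda>y. indicator ?I y *\<^sub>R (?F B y)\<^sup>2)"
    using i1(1) by (intro integrable_mult_indicator) auto
  have "l\<^sup>2 * e / 4 = (LINT y:J|lborel. l\<^sup>2 / 2)"
    unfolding set_lebesgue_integral_def using J by (simp add: less_top)
  also have "\<dots> \<le> (LINT y|lborel. ?h y)"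
  proof -
    have "indicator J y *\<^sub>R (l\<^sup>2 / 2) \<le> ?h y" for y
      using pw[of y] J(4) by (auto simp: indicator_def)
    moreover have "integrable lborel (\<lambda>y. indicator J y *\<^sub>R (l\<^sup>2 / 2))" using J by (simp add: less_top)
    moreover have "integrable lborel ?h" using s i2(1) by (rule Bochner_Integration.integrable_add)
    ultimately have "(LINT y|lborel. indicator J y *\<^sub>R (l\<^sup>2 / 2)) \<le> (LINT y|lborel. ?h y)"
      by (intro integral_mono)
    thus ?thesis by (simp only: set_lebesgue_integral_def)
  qed
  also have "\<dots> = (LINT y:?I|lborel. (?F B y)\<^sup>2) + (LINT y|lborel. (?F (B \<inter> ?I) y)\<^sup>2)"
    using s i2(1) unfolding set_lebesgue_integral_def by (rule Bochner_Integration.integral_add)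
  also have "\<dots> \<le> (LINT y:?I|lborel. (?F B y)\<^sup>2) + pi\<^sup>2 * measure lborel (B \<inter> ?I)"
    using i2(2) by simp
  finally show ?thesis .
qed

text \<open>Links the sharp truncations, in which the principal value is expressed, with the
  regularized kernels, for which the L2 bound holds. At distance at least e from x all kernels are
  dominated by 1/e.\<close>

lemma truncated_kernel_tendsto:
  fixes A :: "real set"
  assumes A[measurable]: "A \<in> sets borel" and fin: "emeasure lborel A < \<infinity>" and e: "0 < e"
    and far: "\<And>t. t \<in> A \<Longrightarrow> e \<le> \<bar>t - x\<bar>"
  shows "(\<lambda>n. LINT t:A|lborel. (t - x) / ((t - x)\<^sup>2 + (inverse (real (Suc n)))\<^sup>2))
    \<longlonglongrightarrow> (LINT t:A|lborel. 1 / (t - x))"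
  unfolding set_lebesgue_integral_def
proof (rule integral_dominated_convergence[where w="\<lambda>t. 1 / e * indicator A t"])
  show "integrable lborel (\<lambda>t. 1 / e * indicator A t)" using fin by (simp add: less_top)
  show "AE t in lborel. (\<lambda>n. indicator A t *\<^sub>R ((t - x) / ((t - x)\<^sup>2 + (inverse (real (Suc n)))\<^sup>2)))
      \<longlonglongrightarrow> indicator A t *\<^sub>R (1 / (t - x))"
  proof (rule AE_I2)
    fix t
    show "(\<lambda>n. indicator A t *\<^sub>R ((t - x) / ((t - x)\<^sup>2 + (inverse (real (Suc n)))\<^sup>2)))
      \<longlonglongrightarrow> indicator A t *\<^sub>R (1 / (t - x))"
    proof (cases "t \<in> A")
      case True
      hence nz: "t - x \<noteq> 0" using far e by fastforce
      have "(\<lambda>n. (t - x) / ((t - x)\<^sup>2 + (inverse (real (Suc n)))\<^sup>2)) \<longlonglongrightarrow> (t - x) / ((t - x)\<^sup>2 + 0\<^sup>2)"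
        using nz by (intro tendsto_intros LIMSEQ_inverse_real_of_nat) auto
      also have "(t - x) / ((t - x)\<^sup>2 + 0\<^sup>2) = 1 / (t - x)" using nz by (simp add: power2_eq_square)
      finally show ?thesis using True by simp
    qed simp
  qed
  show "AE t in lborel. norm (indicator A t *\<^sub>R ((t - x) / ((t - x)\<^sup>2 + (inverse (real (Suc n)))\<^sup>2)))
      \<le> 1 / e * indicator A t" for n
  proof (rule AE_I2)
    fix t
    have "\<bar>(t - x) / ((t - x)\<^sup>2 + (inverse (real (Suc n)))\<^sup>2)\<bar> \<le> 1 / e" if "t \<in> A"
    proof -
      have p: "0 < \<bar>t - x\<bar>" using far[OF that] e by linarith
      hence "\<bar>(t - x) / ((t - x)\<^sup>2 + (inverse (real (Suc n)))\<^sup>2)\<bar> \<le> \<bar>t - x\<bar> / (t - x)\<^sup>2"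
        unfolding abs_divide by (intro divide_left_mono mult_pos_pos) (auto simp: add_pos_nonneg)
      also have "\<dots> = 1 / \<bar>t - x\<bar>" using p by (simp add: divide_simps power2_eq_square)
      also have "\<dots> \<le> 1 / e" using far[OF that] e by (intro divide_left_mono) auto
      finally show ?thesis .
    qed
    thus "norm (indicator A t *\<^sub>R ((t - x) / ((t - x)\<^sup>2 + (inverse (real (Suc n)))\<^sup>2)))
      \<le> 1 / e * indicator A t" by (auto simp: indicator_def)
  qed
qed measurable

lemma sum_set_integral_disjoint_le:
  fixes h :: "real \<Rightarrow> real"
  assumes "finite F" "disjoint_family_on I F" "\<And>i. i \<in> F \<Longrightarrow> I i \<in> sets lborel"
    and h: "integrable lborel h" "\<And>y. 0 \<le> h y"
  shows "(\<Sum>i\<in>F. LINT y:I i|lborel. h y) \<le> (LINT y|lborel. h y)"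
proof -
  have i: "integrable lborel (\<lambda>y. indicator (I i) y *\<^sub>R h y)" if "i \<in> F" for i
    using assms that by (intro integrable_mult_indicator) auto
  have "(\<Sum>i\<in>F. LINT y:I i|lborel. h y) = (LINT y|lborel. (\<Sum>i\<in>F. indicator (I i) y *\<^sub>R h y))"
    unfolding set_lebesgue_integral_def using i by (subst Bochner_Integration.integral_sum) auto
  also have "\<dots> \<le> (LINT y|lborel. h y)"
  proof (rule integral_mono)
    show "(\<Sum>i\<in>F. indicator (I i) y *\<^sub>R h y) \<le> h y" for y
    proof -
      have "(\<Sum>i\<in>F. indicator (I i) y *\<^sub>R h y) = (\<Sum>i\<in>F. indicator (I i) y) * h y"
        by (simp add: sum_distrib_right)
      also have "(\<Sum>i\<in>F. indicator (I i) y) = (indicator (\<Union>i\<in>F. I i) y :: real)"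
        by (rule indicator_UN_disjoint[OF assms(1,2), symmetric])
      finally have "(\<Sum>i\<in>F. indicator (I i) y *\<^sub>R h y) = indicator (\<Union>i\<in>F. I i) y * h y" .
      thus ?thesis using h(2)[of y] by (simp add: indicator_def)
    qed
  qed (use i h in auto)
  finally show ?thesis .
qed

text \<open>Over disjoint intervals the local estimates add up to at most the global L2 bound plus
  the near parts, pi^2 |B| each. S is the union of the fivefold enlarged balls of a Vitali
  subfamily, so it is measurable by construction and only has to contain the exceptional
  points.\<close>

lemma maximal_truncated_hilbert:
  fixes B :: "real set"
  assumes B[measurable]: "B \<in> sets borel" and sub: "B \<subseteq> {-1<..<1}" and l: "0 < l"
  obtains S where "S \<in> lmeasurable" "measure lebesgue S \<le> 80 * pi\<^sup>2 * measure lborel B / l\<^sup>2"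
    "\<And>x e. x \<in> {-1<..<1} \<Longrightarrow> 0 < e \<Longrightarrow> l < \<bar>LINT t:(B - {x-e..x+e})|lborel. 1 / (t - x)\<bar> \<Longrightarrow> x \<in> S"
proof -
  define K where "K = {(x, e). x \<in> {-1<..<1} \<and> 0 < e \<and> l < \<bar>LINT t:(B - {x-e..x+e})|lborel. 1 / (t - x)\<bar>}"
  have fin: "emeasure lborel B < \<infinity>"
    using emeasure_mono[OF sub, of lborel] by (auto simp: ennreal_numeral[symmetric] intro: le_less_trans simp del: ennreal_numeral)
  \<comment> \<open>The covering lemma requires bounded radii. A window of radius above 2 around a
    point of (-1,1) swallows B, and the truncated integral is then 0.\<close>
  have K: "0 < snd i \<and> snd i \<le> 2" if "i \<in> K" for i
  proof -
    obtain x e where i: "i = (x, e)" by force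
    have xe: "x \<in> {-1<..<1}" "0 < e" "l < \<bar>LINT t:(B - {x-e..x+e})|lborel. 1 / (t - x)\<bar>"
      using that by (auto simp: K_def i)
    have "e \<le> 2"
    proof (rule ccontr)
      assume "\<not> e \<le> 2"
      hence "B - {x-e..x+e} = {}" using sub xe(1) by fastforce
      hence "(LINT t:(B - {x-e..x+e})|lborel. 1 / (t - x)) = 0" by (simp only:) (simp add: set_lebesgue_integral_def)
      thus False using xe(3) l by linarith
    qed
    thus ?thesis using xe i by simp
  qed
  have cov: "{x. \<exists>e. (x, e) \<in> K} \<subseteq> (\<Union>i\<in>K. cball (fst i) (snd i))" using K by fastforce
  obtain C where C: "countable C" "C \<subseteq> K"
    "pairwise (\<lambda>i j. disjnt (cball (fst i) (snd i)) (cball (fst j) (snd j))) C"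
    "{x. \<exists>e. (x, e) \<in> K} \<subseteq> (\<Union>i\<in>C. cball (fst i) (5 * snd i))"
    by (rule Vitali_covering_lemma_cballs[OF cov K])
  let ?I = "\<lambda>i. {fst i - snd i..fst i + snd i}"
  \<comment> \<open>The 8 is 4 from the local estimate times the 2 of the two pi^2 |B|
    contributions. A fivefold ball of radius \<open>snd i\<close> has length
    \<open>10 * snd i\<close>, which turns 8 into 80.\<close>
  let ?b = "8 * pi\<^sup>2 * measure lborel B / l\<^sup>2"
  \<comment> \<open>Finite subfamilies are used so that one d can lie below half of every radius and
    keep all the regularized integrals above l.\<close>
  have main: "(\<Sum>i\<in>F. snd i) \<le> ?b" if F: "F \<subseteq> C" "finite F" for F
  proof -
    let ?d = "\<lambda>n. inverse (real (Suc n))"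
    have ev: "\<forall>\<^sub>F n in sequentially. ?d n < snd i / 2 \<and>
        l < \<bar>LINT t:(B - ?I i)|lborel. (t - fst i) / ((t - fst i)\<^sup>2 + (?d n)\<^sup>2)\<bar>" if "i \<in> F" for i
    proof (rule eventually_conj)
      have i: "0 < snd i" "l < \<bar>LINT t:(B - ?I i)|lborel. 1 / (t - fst i)\<bar>"
        using that F C(2) unfolding K_def by auto
      show "\<forall>\<^sub>F n in sequentially. ?d n < snd i / 2"
        by (rule order_tendstoD(2)[OF LIMSEQ_inverse_real_of_nat]) (use i in simp)
      have "(\<lambda>n. LINT t:(B - ?I i)|lborel. (t - fst i) / ((t - fst i)\<^sup>2 + (?d n)\<^sup>2)) \<longlonglongrightarrow> (LINT t:(B - ?I i)|lborel. 1 / (t - fst i))"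
        by (rule truncated_kernel_tendsto[where e="snd i"]) (use i fin in \<open>auto intro: le_less_trans[OF emeasure_mono]\<close>)
      from order_tendstoD(1)[OF tendsto_rabs[OF this] i(2)]
      show "\<forall>\<^sub>F n in sequentially. l < \<bar>LINT t:(B - ?I i)|lborel. (t - fst i) / ((t - fst i)\<^sup>2 + (?d n)\<^sup>2)\<bar>" .
    qed
    have "\<forall>\<^sub>F n in sequentially. \<forall>i\<in>F. ?d n < snd i / 2 \<and>
        l < \<bar>LINT t:(B - ?I i)|lborel. (t - fst i) / ((t - fst i)\<^sup>2 + (?d n)\<^sup>2)\<bar>"
      using ev by (intro eventually_ball_finite[OF F(2)]) auto
    then obtain n where n: "\<And>i. i \<in> F \<Longrightarrow> ?d n < snd i / 2"
        "\<And>i. i \<in> F \<Longrightarrow> l < \<bar>LINT t:(B - ?I i)|lborel. (t - fst i) / ((t - fst i)\<^sup>2 + (?d n)\<^sup>2)\<bar>"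
      unfolding eventually_sequentially by blast
    define d where "d = ?d n"
    have d: "d > 0" unfolding d_def by simp
    let ?F = "\<lambda>y. (LINT t:B|lborel. (t - y) / ((t - y)\<^sup>2 + d\<^sup>2))\<^sup>2"
    note L2 = conjugate_poisson_L2[OF B fin d]
    let ?h = "\<lambda>y. ?F y + pi\<^sup>2 * indicator B y"
    have iB: "integrable lborel (\<lambda>y. pi\<^sup>2 * indicator B y)" using fin by (simp add: less_top)
    have h: "integrable lborel ?h" using L2(1) iB by (rule Bochner_Integration.integrable_add)
    have "(\<Sum>i\<in>F. l\<^sup>2 * snd i / 4) \<le> (\<Sum>i\<in>F. LINT y:?I i|lborel. ?h y)"
    proof (rule sum_mono)
      fix i assume i: "i \<in> F"
      have "(LINT y:?I i|lborel. ?h y) = (LINT y:?I i|lborel. ?F y) + (LINT y:?I i|lborel. pi\<^sup>2 * indicator B y)"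
        by (rule set_integral_add) (auto simp: set_integrable_def intro!: integrable_mult_indicator L2(1) iB simp del: scaleR_conv_of_real real_scaleR_def)
      also have "(LINT y:?I i|lborel. pi\<^sup>2 * indicator B y) = (LINT y|lborel. pi\<^sup>2 * indicator (B \<inter> ?I i) y)"
        unfolding set_lebesgue_integral_def by (rule Bochner_Integration.integral_cong) (auto simp: indicator_def)
      also have "\<dots> = pi\<^sup>2 * measure lborel (B \<inter> ?I i)" by simp
      finally show "l\<^sup>2 * snd i / 4 \<le> (LINT y:?I i|lborel. ?h y)"
        using truncated_hilbert_local[OF B fin d _ l, of "snd i" "fst i"] n[OF i] unfolding d_def by simp
    qed
    also have "\<dots> \<le> (LINT y|lborel. ?h y)"
    proof (rule sum_set_integral_disjoint_le[OF F(2)])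
      show "disjoint_family_on ?I F"
        unfolding disjoint_family_on_def
      proof (intro ballI impI)
        fix i j assume "i \<in> F" "j \<in> F" "i \<noteq> j"
        hence "disjnt (cball (fst i) (snd i)) (cball (fst j) (snd j))" using pairwiseD[OF C(3)] F(1) by blast
        thus "?I i \<inter> ?I j = {}" by (simp add: disjnt_def cball_eq_atLeastAtMost)
      qed
    qed (use h in auto)
    also have "\<dots> = (LINT y|lborel. ?F y) + pi\<^sup>2 * measure lborel B"
      using L2(1) iB by (subst Bochner_Integration.integral_add) auto
    also have "\<dots> \<le> 2 * pi\<^sup>2 * measure lborel B" using L2(2) by linarith
    finally have "(l\<^sup>2 / 4) * (\<Sum>i\<in>F. snd i) \<le> 2 * pi\<^sup>2 * measure lborel B"
      by (simp add: sum_distrib_left sum_divide_distrib)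
    thus ?thesis using l by (simp add: field_simps)
  qed
  define S where "S = (\<Union>i\<in>C. cball (fst i) (5 * snd i))"
  have bd: "measure lebesgue (\<Union>i\<in>F. cball (fst i) (5 * snd i)) \<le> 10 * ?b" if F: "F \<subseteq> C" "finite F" for F
  proof -
    have "measure lebesgue (\<Union>i\<in>F. cball (fst i) (5 * snd i)) \<le> (\<Sum>i\<in>F. measure lebesgue (cball (fst i) (5 * snd i)))"
      by (rule measure_UNION_le[OF F(2)]) auto
    also have "\<dots> = (\<Sum>i\<in>F. 10 * snd i)"
    proof (rule sum.cong[OF refl])
      fix i assume "i \<in> F"
      hence "0 < snd i" using K C(2) F by blast
      thus "measure lebesgue (cball (fst i) (5 * snd i)) = 10 * snd i" by (simp add: cball_eq_atLeastAtMost)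
    qed
    also have "\<dots> = 10 * (\<Sum>i\<in>F. snd i)" by (simp add: sum_distrib_left)
    finally show ?thesis using main[OF F] by linarith
  qed
  show ?thesis
  proof (rule that[of S])
    show "S \<in> lmeasurable" unfolding S_def by (rule fmeasurable_UN_bound[OF C(1) _ bd]) auto
    have "measure lebesgue S \<le> 10 * ?b" unfolding S_def by (rule measure_UN_bound[OF C(1) _ bd]) auto
    thus "measure lebesgue S \<le> 80 * pi\<^sup>2 * measure lborel B / l\<^sup>2" by simp
    show "x \<in> S" if "x \<in> {-1<..<1}" "0 < e" "l < \<bar>LINT t:(B - {x-e..x+e})|lborel. 1 / (t - x)\<bar>" for x e
      using that C(4) unfolding S_def K_def by blast
  qed
qed

subsection \<open>Existence of principal values\<close>

abbreviation trunc_dom :: "real \<Rightarrow> real \<Rightarrow> real set" where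
  "trunc_dom x e \<equiv> {-1<..<1} - {x-e..x+e}"

lemma borel_measurable_lebesgue_ident: "(\<lambda>x::real. x) \<in> borel_measurable lebesgue"
  by (rule measurable_completion) measurable

text \<open>The reflection t -> 2x - t preserves the annulus and reverses the sign of the
  kernel.\<close>

lemma odd_annulus_integral:
  fixes x e e' :: real
  shows "(LINT t:({x-e'..x+e'} - {x-e..x+e})|lborel. 1 / (t - x)) = 0"
proof -
  let ?f = "\<lambda>t. indicator ({x-e'..x+e'} - {x-e..x+e}) t *\<^sub>R (1 / (t - x))"
  have "(LINT t|lborel. ?f t) = (LINT t|lborel. ?f (2 * x + -1 * t))"
    using lborel_integral_real_affine[of "-1" ?f "2 * x"] by simp
  also have "\<dots> = (LINT t|lborel. - ?f t)"
    by (rule Bochner_Integration.integral_cong) (auto simp: indicator_def divide_simps)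
  finally show ?thesis by (simp add: set_lebesgue_integral_def)
qed

lemma at_right_limit_of_cauchy:
  fixes S :: "real \<Rightarrow> real"
  assumes "\<And>l. l > 0 \<Longrightarrow> \<exists>r>0. \<forall>e e'. 0 < e \<and> e < r \<and> 0 < e' \<and> e' < r \<longrightarrow> \<bar>S e - S e'\<bar> \<le> l"
  shows "\<exists>L. (S \<longlongrightarrow> L) (at_right 0)"
proof -
  let ?u = "\<lambda>n. S (inverse (real (Suc n)))"
  have ev: "\<exists>M. \<forall>n\<ge>M. inverse (real (Suc n)) < r" if "r > 0" for r
    using order_tendstoD(2)[OF LIMSEQ_inverse_real_of_nat that] by (simp add: eventually_sequentially)
  have "Cauchy ?u"
  proof (rule metric_CauchyI)
    fix l :: real assume l: "0 < l"
    obtain r where r: "r > 0" "\<And>e e'. 0 < e \<Longrightarrow> e < r \<Longrightarrow> 0 < e' \<Longrightarrow> e' < r \<Longrightarrow> \<bar>S e - S e'\<bar> \<le> l / 2"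
      using assms[of "l / 2"] l by (metis half_gt_zero)
    obtain M where M: "\<And>n. n \<ge> M \<Longrightarrow> inverse (real (Suc n)) < r" using ev[OF r(1)] by blast
    have "dist (?u m) (?u n) < l" if "m \<ge> M" "n \<ge> M" for m n
      using r(2)[OF _ M[OF that(1)] _ M[OF that(2)]] l by (simp add: dist_real_def)
    thus "\<exists>M. \<forall>m\<ge>M. \<forall>n\<ge>M. dist (?u m) (?u n) < l" by blast
  qed
  then obtain L where L: "?u \<longlonglongrightarrow> L" using Cauchy_convergent convergent_def by blast
  have "(S \<longlongrightarrow> L) (at_right 0)"
  proof (rule tendstoI)
    fix l :: real assume l: "0 < l"
    obtain r where r: "r > 0" "\<And>e e'. 0 < e \<Longrightarrow> e < r \<Longrightarrow> 0 < e' \<Longrightarrow> e' < r \<Longrightarrow> \<bar>S e - S e'\<bar> \<le> l / 2"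
      using assms[of "l / 2"] l by (metis half_gt_zero)
    obtain M where M: "\<And>n. n \<ge> M \<Longrightarrow> inverse (real (Suc n)) < r" using ev[OF r(1)] by blast
    have "dist (S e) L < l" if e: "0 < e" "e < r" for e
    proof -
      have "\<bar>S e - L\<bar> \<le> l / 2"
      proof (rule tendsto_upperbound)
        show "(\<lambda>n. \<bar>S e - ?u n\<bar>) \<longlonglongrightarrow> \<bar>S e - L\<bar>" by (intro tendsto_intros L)
        show "\<forall>\<^sub>F n in sequentially. \<bar>S e - ?u n\<bar> \<le> l / 2"
          unfolding eventually_sequentially using r(2)[OF e _ M] by (intro exI[of _ M]) auto
      qed simp
      thus ?thesis using l by (simp add: dist_real_def)
    qed
    thus "\<forall>\<^sub>F e in at_right 0. dist (S e) L < l"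
      unfolding eventually_at_right_field using r(1) by blast
  qed
  thus ?thesis by blast
qed

lemma set_integrable_truncated:
  fixes A :: "real set"
  assumes A: "A \<in> sets lebesgue" "A \<subseteq> {-1<..<1}" and e: "0 < e"
  shows "set_integrable lebesgue (A - {x-e..x+e}) (\<lambda>t. 1 / (t - x))"
proof -
  note borel_measurable_lebesgue_ident[measurable]
  show ?thesis
  proof (rule set_integrable_bounded[where c="1/e"])
  have "emeasure lebesgue (A - {x-e..x+e}) \<le> emeasure lebesgue {-1<..<1::real}"
    using A by (intro emeasure_mono) auto
  also have "\<dots> < \<infinity>" by simp
  finally show "emeasure lebesgue (A - {x-e..x+e}) < \<infinity>" .
  show "\<bar>1 / (t - x)\<bar> \<le> 1 / e" if "t \<in> A - {x-e..x+e}" for t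
  proof -
    have "e \<le> \<bar>t - x\<bar>" using that by (auto simp: abs_if)
    thus ?thesis using e by (auto intro!: divide_left_mono mult_pos_pos)
  qed
  qed (use A in auto)
qed

text \<open>At a point of \<open>A\<close> the indicator of an open \<open>U \<supseteq> A\<close> is locally constant and, the kernel being odd,
  does not contribute to the oscillation; the maximal inequality controls \<open>U - A\<close>.\<close>
lemma truncated_hilbert_limit_in_set:
  fixes A :: "real set"
  assumes A[measurable]: "A \<in> sets lebesgue" and sub: "A \<subseteq> {-1<..<1}"
  shows "\<exists>N. negligible N \<and> (\<forall>x\<in>A - N. \<exists>L. ((\<lambda>e. LINT t:(A - {x-e..x+e})|lebesgue. 1 / (t - x)) \<longlongrightarrow> L) (at_right 0))"
proof -
  let ?S = "\<lambda>A x e. LINT t:(A - {x-e..x+e})|lebesgue. 1 / (t - x)"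
  \<comment> \<open>The factor 2 lets a large oscillation be charged to one of two truncations: if
    their difference exceeds 2 l, one of them exceeds l in absolute value.\<close>
  define bad where "bad l = {x\<in>A. \<forall>r>0. \<exists>e e'. 0 < e \<and> e < r \<and> 0 < e' \<and> e' < r \<and> 2 * l < \<bar>?S A x e - ?S A x e'\<bar>}" for l
  have bad: "negligible (bad l)" if l: "l > 0" for l
    unfolding negligible_outer_le
  proof (intro allI impI)
    fix h :: real assume h: "h > 0"
    \<comment> \<open>Chosen so that the maximal inequality at level l, for a set of measure at most
      \<open>th\<close>, gives an exceptional set of measure at most h.\<close>
    define th where "th = h * l\<^sup>2 / (80 * pi\<^sup>2)"
    have th: "th > 0" unfolding th_def using h l by simp
    obtain U0 where U0: "open U0" "A \<subseteq> U0" "U0 - A \<in> lmeasurable" "emeasure lebesgue (U0 - A) < ennreal th"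
      using sets_lebesgue_outer_open[OF A th] by blast
    define U where "U = U0 \<inter> {-1<..<1}"
    have U: "open U" "A \<subseteq> U" "U \<subseteq> {-1<..<1}" "U \<in> sets lebesgue" unfolding U_def using U0 sub by auto
    define V where "V = U - A"
    have V[measurable]: "V \<in> sets lebesgue" and Vsub: "V \<subseteq> {-1<..<1}" unfolding V_def using U by auto
    have "emeasure lebesgue V \<le> emeasure lebesgue (U0 - A)"
      using U0 unfolding V_def U_def by (intro emeasure_mono) auto
    also have "\<dots> < ennreal th" by fact
    finally have mV: "emeasure lebesgue V < ennreal th" .
    \<comment> \<open>The maximal inequality is stated for Borel sets, while V is only Lebesgue
      measurable; a null set T makes up the difference and leaves the integrals unchanged.\<close>
    obtain B T where BT: "fsigma B" "negligible T" "B \<union> T = V" "disjnt B T"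
      using lebesgue_set_almost_fsigma[OF V] unfolding negligible_iff_null_sets by metis
    have B[measurable]: "B \<in> sets borel"
      using BT(1) by (auto elim!: fsigma.cases)
    have Bsub: "B \<subseteq> {-1<..<1}" using BT Vsub by auto
    have "emeasure lborel B = emeasure lebesgue B" by simp
    also have "\<dots> \<le> emeasure lebesgue V" using BT by (intro emeasure_mono) auto
    finally have "emeasure lborel B < ennreal th" using mV by simp
    hence mB: "measure lborel B \<le> th"
      using th unfolding measure_def by (metis enn2real_leI less_imp_le)
    obtain S where S: "S \<in> lmeasurable" "measure lebesgue S \<le> 80 * pi\<^sup>2 * measure lborel B / l\<^sup>2"
      "\<And>x e. x \<in> {-1<..<1} \<Longrightarrow> 0 < e \<Longrightarrow> l < \<bar>LINT t:(B - {x-e..x+e})|lborel. 1 / (t - x)\<bar> \<Longrightarrow> x \<in> S"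
      using maximal_truncated_hilbert[OF B Bsub l] by blast
    have SV: "?S V x e = (LINT t:(B - {x-e..x+e})|lborel. 1 / (t - x))" for x e
    proof -
      have mB: "(\<lambda>t. indicator (B - {x-e..x+e}) t *\<^sub>R (1 / (t - x))) \<in> borel_measurable lborel" by measurable
      note borel_measurable_lebesgue_ident[measurable]
      have [measurable]: "B \<in> sets lebesgue" by simp
      have "AE t in lebesgue. t \<notin> T" using BT(2) by (rule AE_not_in[OF negligible_iff_null_sets[THEN iffD1]])
      hence "AE t in lebesgue. indicator (V - {x-e..x+e}) t *\<^sub>R (1 / (t - x)) = indicator (B - {x-e..x+e}) t *\<^sub>R (1 / (t - x))"
        by eventually_elim (use BT(3) in \<open>auto simp: indicator_def\<close>)
      hence "?S V x e = (LINT t|lebesgue. indicator (B - {x-e..x+e}) t *\<^sub>R (1 / (t - x)))"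
        unfolding set_lebesgue_integral_def by (intro integral_cong_AE) measurable
      also have "\<dots> = (LINT t:(B - {x-e..x+e})|lborel. 1 / (t - x))"
        unfolding set_lebesgue_integral_def by (rule integral_completion[OF mB])
      finally show ?thesis .
    qed
    have split: "?S A x e = ?S U x e - ?S V x e" if "e > 0" for x e
    proof -
      have "U - {x-e..x+e} = (A - {x-e..x+e}) \<union> (V - {x-e..x+e})" using U(2) unfolding V_def by auto
      hence "?S U x e = (LINT t:((A - {x-e..x+e}) \<union> (V - {x-e..x+e}))|lebesgue. 1 / (t - x))" by simp
      also have "\<dots> = ?S A x e + ?S V x e"
        by (rule set_integral_Un) (use that sub Vsub sets.Diff[OF U(4) A] in \<open>auto intro!: set_integrable_truncated simp: V_def\<close>)
      finally show ?thesis by simp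
    qed
    have Uc: "?S U x e = ?S U x e'" if e: "0 < e" "e \<le> e'" and b: "{x-e'..x+e'} \<subseteq> U" for x e e'
    proof -
      have "U - {x-e..x+e} = (U - {x-e'..x+e'}) \<union> ({x-e'..x+e'} - {x-e..x+e})" using e b by auto
      hence "?S U x e = (LINT t:((U - {x-e'..x+e'}) \<union> ({x-e'..x+e'} - {x-e..x+e}))|lebesgue. 1 / (t - x))" by simp
      also have "\<dots> = ?S U x e' + ?S {x-e'..x+e'} x e"
        by (rule set_integral_Un) (use e b U in \<open>auto intro!: set_integrable_truncated\<close>)
      also have "?S {x-e'..x+e'} x e = 0"
        using odd_annulus_integral[of x e' e] by (simp add: set_lebesgue_integral_def integral_completion)
      finally show ?thesis by simp
    qed
    have "bad l \<subseteq> S"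
    proof
      fix x assume x: "x \<in> bad l"
      hence xA: "x \<in> A" unfolding bad_def by simp
      then obtain r where r: "r > 0" "ball x r \<subseteq> U" using U(1,2) openE by blast
      obtain e e' where e: "0 < e" "e < r" "0 < e'" "e' < r" "2 * l < \<bar>?S A x e - ?S A x e'\<bar>"
        using x r(1) unfolding bad_def by blast
      have sb: "{x-e..x+e} \<subseteq> U" if "e < r" for e using that r(2) by (auto simp: ball_eq_greaterThanLessThan)
      have "?S U x e = ?S U x e'"
      proof (cases "e \<le> e'")
        case True
        thus ?thesis using Uc[OF e(1) True sb[OF e(4)]] by simp
      next
        case False
        thus ?thesis using Uc[OF e(3) _ sb[OF e(2)]] by simp
      qed
      hence "2 * l < \<bar>?S V x e - ?S V x e'\<bar>" using e split[of e x] split[of e' x] by simp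
      hence "l < \<bar>?S V x e\<bar> \<or> l < \<bar>?S V x e'\<bar>" by linarith
      thus "x \<in> S" using S(3)[of x e] S(3)[of x e'] e xA sub unfolding SV by blast
    qed
    moreover have "measure lebesgue S \<le> h"
    proof -
      have "80 * pi\<^sup>2 * measure lborel B / l\<^sup>2 \<le> 80 * pi\<^sup>2 * th / l\<^sup>2"
        using mB by (intro divide_right_mono mult_left_mono) auto
      also have "\<dots> = h" unfolding th_def using l by simp
      finally show ?thesis using S(2) by linarith
    qed
    ultimately show "\<exists>T. bad l \<subseteq> T \<and> T \<in> lmeasurable \<and> measure lebesgue T \<le> h" using S(1) by blast
  qed
  define N where "N = (\<Union>n. bad (1 / real (Suc n)))"
  have "negligible N" unfolding N_def by (rule negligible_countable_Union) (use bad in auto)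
  moreover have "\<exists>L. (?S A x \<longlongrightarrow> L) (at_right 0)" if x: "x \<in> A - N" for x
  proof (rule at_right_limit_of_cauchy)
    fix l :: real assume "l > 0"
    then obtain n where n: "1 / real (Suc n) < l / 2" using nat_approx_posE[of "l/2"] by auto
    have "x \<notin> bad (1 / real (Suc n))" using x unfolding N_def by blast
    then obtain r where "r > 0" "\<And>e e'. 0 < e \<Longrightarrow> e < r \<Longrightarrow> 0 < e' \<Longrightarrow> e' < r \<Longrightarrow> \<bar>?S A x e - ?S A x e'\<bar> \<le> 2 * (1 / real (Suc n))"
      using x unfolding bad_def by (force simp: not_less)
    thus "\<exists>r>0. \<forall>e e'. 0 < e \<and> e < r \<and> 0 < e' \<and> e' < r \<longrightarrow> \<bar>?S A x e - ?S A x e'\<bar> \<le> l"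
      using n by (intro exI[of _ r]) force
  qed
  ultimately show ?thesis by blast
qed

text \<open>So far limits exist only at points of the set itself. A point outside A belongs both to
  the full interval and to the complement of A in it, and the indicator of A is the difference of
  these two indicators.\<close>

lemma truncated_hilbert_limit_set:
  fixes A :: "real set"
  assumes A[measurable]: "A \<in> sets lebesgue" and sub: "A \<subseteq> {-1<..<1}"
  shows "\<exists>N. negligible N \<and> (\<forall>x\<in>{-1<..<1} - N. \<exists>L. ((\<lambda>e. LINT t:(A - {x-e..x+e})|lebesgue. 1 / (t - x)) \<longlongrightarrow> L) (at_right 0))"
proof -
  let ?D = "{-1<..<1::real}"
  let ?S = "\<lambda>A x e. LINT t:(A - {x-e..x+e})|lebesgue. 1 / (t - x)"
  obtain N1 where N1: "negligible N1" "\<And>x. x \<in> A - N1 \<Longrightarrow> \<exists>L. (?S A x \<longlongrightarrow> L) (at_right 0)"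
    using truncated_hilbert_limit_in_set[OF A sub] by blast
  have "?D - A \<in> sets lebesgue" by auto
  then obtain N2 where N2: "negligible N2" "\<And>x. x \<in> (?D - A) - N2 \<Longrightarrow> \<exists>L. (?S (?D - A) x \<longlongrightarrow> L) (at_right 0)"
    using truncated_hilbert_limit_in_set[of "?D - A"] by auto
  obtain N3 where N3: "negligible N3" "\<And>x. x \<in> ?D - N3 \<Longrightarrow> \<exists>L. (?S ?D x \<longlongrightarrow> L) (at_right 0)"
    using truncated_hilbert_limit_in_set[of ?D] by auto
  have split: "?S A x e = ?S ?D x e - ?S (?D - A) x e" if "e > 0" for x e
  proof -
    have "?D - {x-e..x+e} = (A - {x-e..x+e}) \<union> ((?D - A) - {x-e..x+e})" using sub by auto
    hence "?S ?D x e = (LINT t:((A - {x-e..x+e}) \<union> ((?D - A) - {x-e..x+e}))|lebesgue. 1 / (t - x))" by simp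
    also have "\<dots> = ?S A x e + ?S (?D - A) x e"
      by (rule set_integral_Un) (use that sub in \<open>auto intro!: set_integrable_truncated\<close>)
    finally show ?thesis by simp
  qed
  have "\<exists>L. (?S A x \<longlongrightarrow> L) (at_right 0)" if x: "x \<in> ?D - (N1 \<union> N2 \<union> N3)" for x
  proof (cases "x \<in> A")
    case True thus ?thesis using N1(2) x by blast
  next
    case False
    obtain L2 L3 where L: "(?S (?D - A) x \<longlongrightarrow> L2) (at_right 0)" "(?S ?D x \<longlongrightarrow> L3) (at_right 0)"
      using N2(2)[of x] N3(2)[of x] x False by blast
    have "\<forall>\<^sub>F e in at_right 0. ?S ?D x e - ?S (?D - A) x e = ?S A x e"
      using eventually_at_right_less[of "0::real"] by eventually_elim (simp add: split)
    from tendsto_cong[OF this] tendsto_diff[OF L(2,1)] show ?thesis by blast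
  qed
  thus ?thesis using N1(1) N2(1) N3(1) by (intro exI[of _ "N1 \<union> N2 \<union> N3"]) (auto intro: negligible_Un)
qed

section \<open>Principal values of simple functions and of their Lipschitz multiples\<close>

lemma emeasure_subset_I11_finite: "A \<subseteq> {-1<..<1::real} \<Longrightarrow> emeasure lebesgue A < \<infinity>"
proof -
  assume "A \<subseteq> {-1<..<1}"
  hence "emeasure lebesgue A \<le> emeasure lebesgue {-1<..<1::real}" by (intro emeasure_mono) auto
  also have "\<dots> < \<infinity>" by simp
  finally show ?thesis .
qed

lemma set_integrable_bounded_I11:
  fixes h :: "real \<Rightarrow> real"
  assumes "h \<in> borel_measurable lebesgue" "A \<in> sets lebesgue" "A \<subseteq> {-1<..<1}" "\<And>t. t \<in> A \<Longrightarrow> \<bar>h t\<bar> \<le> c"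
  shows "set_integrable lebesgue A h"
  using assms by (intro set_integrable_bounded emeasure_subset_I11_finite) auto

lemma truncated_hilbert_limit_simple:
  fixes s :: "real \<Rightarrow> real"
  assumes s: "simple_function lebesgue s"
  shows "\<exists>N. negligible N \<and> (\<forall>x\<in>{-1<..<1} - N. \<exists>L. ((\<lambda>e. LINT t:trunc_dom x e|lebesgue. s t / (t - x)) \<longlongrightarrow> L) (at_right 0))"
proof -
  let ?D = "{-1<..<1::real}"
  define A where "A y = s -` {y} \<inter> ?D" for y
  have fin: "finite (range s)" using simple_functionD(1)[OF s] by simp
  have A[measurable]: "A y \<in> sets lebesgue" for y unfolding A_def using simple_functionD(2)[OF s, of "{y}"] by auto
  have Asub: "A y \<subseteq> ?D" for y unfolding A_def by auto
  let ?S = "\<lambda>y x e. LINT t:(A y - {x-e..x+e})|lebesgue. 1 / (t - x)"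
  obtain N where N: "\<And>y. negligible (N y)" "\<And>y x. x \<in> ?D - N y \<Longrightarrow> \<exists>L. (?S y x \<longlongrightarrow> L) (at_right 0)"
    using truncated_hilbert_limit_set[OF A Asub] by metis
  have "negligible (\<Union>y\<in>range s. N y)" using fin N(1) by (intro negligible_Union) auto
  moreover have "\<exists>L. ((\<lambda>e. LINT t:trunc_dom x e|lebesgue. s t / (t - x)) \<longlongrightarrow> L) (at_right 0)"
    if x: "x \<in> ?D - (\<Union>y\<in>range s. N y)" for x
  proof -
    have "\<forall>y\<in>range s. \<exists>L. (?S y x \<longlongrightarrow> L) (at_right 0)" using N(2) x by blast
    then obtain L where L: "\<And>y. y \<in> range s \<Longrightarrow> (?S y x \<longlongrightarrow> L y) (at_right 0)" by metis
    have eq: "(LINT t:trunc_dom x e|lebesgue. s t / (t - x)) = (\<Sum>y\<in>range s. y * ?S y x e)" if e: "e > 0" for e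
    proof -
      have pt: "indicator (trunc_dom x e) t *\<^sub>R (s t / (t - x)) =
          (\<Sum>y\<in>range s. y * (indicator (A y - {x-e..x+e}) t *\<^sub>R (1 / (t - x))))" for t
      proof -
        have "(\<Sum>y\<in>range s. y * (indicator (A y - {x-e..x+e}) t *\<^sub>R (1 / (t - x)))) =
          (\<Sum>y\<in>{s t}. y * (indicator (A y - {x-e..x+e}) t *\<^sub>R (1 / (t - x))))"
          using fin by (intro sum.mono_neutral_right) (auto simp: A_def indicator_def)
        thus ?thesis by (auto simp: A_def indicator_def)
      qed
      have "(LINT t|lebesgue. (\<Sum>y\<in>range s. y * (indicator (A y - {x-e..x+e}) t *\<^sub>R (1 / (t - x))))) = (\<Sum>y\<in>range s. y * ?S y x e)"
      proof (subst Bochner_Integration.integral_sum)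
        show "integrable lebesgue (\<lambda>t. y * (indicator (A y - {x-e..x+e}) t *\<^sub>R (1 / (t - x))))" for y
          using set_integrable_truncated[OF A[of y] Asub e, of x] unfolding set_integrable_def
          by (intro integrable_mult_right)
      qed (simp only: integral_mult_right_zero set_lebesgue_integral_def)
      thus ?thesis unfolding set_lebesgue_integral_def[of _ "trunc_dom x e"] pt .
    qed
    have "((\<lambda>e. \<Sum>y\<in>range s. y * ?S y x e) \<longlongrightarrow> (\<Sum>y\<in>range s. y * L y)) (at_right 0)"
      by (intro tendsto_intros L)
    moreover have "\<forall>\<^sub>F e in at_right 0. (\<Sum>y\<in>range s. y * ?S y x e) = (LINT t:trunc_dom x e|lebesgue. s t / (t - x))"
      using eventually_at_right_less[of "0::real"] by eventually_elim (simp add: eq)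
    ultimately show ?thesis by (blast intro: Lim_transform_eventually)
  qed
  ultimately show ?thesis by blast
qed

lemma integral_trunc_dom_tendsto:
  fixes h :: "real \<Rightarrow> real"
  assumes h[measurable]: "h \<in> borel_measurable lebesgue" and bd: "\<And>t. \<bar>h t\<bar> \<le> c"
  shows "((\<lambda>e. LINT t:trunc_dom x e|lebesgue. h t) \<longlongrightarrow> (LINT t:{-1<..<1}|lebesgue. h t)) (at_right 0)"
proof -
  let ?D = "{-1<..<1::real}"
  have c: "c \<ge> 0" using bd[of 0] by linarith
  have est: "dist (LINT t:trunc_dom x e|lebesgue. h t) (LINT t:?D|lebesgue. h t) \<le> c * (2 * e)" if e: "e > 0" for e
  proof -
    have "(LINT t:(trunc_dom x e \<union> (?D \<inter> {x-e..x+e}))|lebesgue. h t)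
        = (LINT t:trunc_dom x e|lebesgue. h t) + (LINT t:(?D \<inter> {x-e..x+e})|lebesgue. h t)"
      by (rule set_integral_Un) (auto intro!: set_integrable_bounded_I11 bd)
    moreover have "trunc_dom x e \<union> (?D \<inter> {x-e..x+e}) = ?D" by auto
    ultimately have "dist (LINT t:trunc_dom x e|lebesgue. h t) (LINT t:?D|lebesgue. h t)
        = \<bar>LINT t:(?D \<inter> {x-e..x+e})|lebesgue. h t\<bar>" by (simp add: dist_real_def)
    also have "\<dots> \<le> (LINT t|lebesgue. c * indicator {x-e..x+e} t)"
      unfolding set_lebesgue_integral_def
    proof (rule integral_abs_bound[THEN order_trans], rule integral_mono)
      have *: "integrable lebesgue (\<lambda>t. indicator (?D \<inter> {x-e..x+e}) t *\<^sub>R h t)"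
        using set_integrable_bounded_I11[OF h, of "?D \<inter> {x-e..x+e}" c] bd by (auto simp: set_integrable_def)
      show "integrable lebesgue (\<lambda>t. c * indicator {x-e..x+e} t)"
        by (intro integrable_mult_right integrable_real_indicator) (auto simp: emeasure_lborel_Icc_eq)
      show "integrable lebesgue (\<lambda>t. \<bar>indicator (?D \<inter> {x-e..x+e}) t *\<^sub>R h t\<bar>)" by (rule integrable_abs[OF *])
    qed (use bd c in \<open>auto simp: indicator_def\<close>)
    also have "\<dots> = c * (2 * e)" using e by simp
    finally show ?thesis .
  qed
  show ?thesis unfolding tendsto_dist_iff[of "\<lambda>e. LINT t:trunc_dom x e|lebesgue. h t"]
  proof (rule tendsto_sandwich[OF _ _ tendsto_const])
    show "((\<lambda>e. c * (2 * e)) \<longlongrightarrow> 0) (at_right 0)"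
      by (auto intro!: tendsto_eq_intros)
    show "\<forall>\<^sub>F e in at_right 0. dist (LINT t:trunc_dom x e|lebesgue. h t) (LINT t:?D|lebesgue. h t) \<le> c * (2 * e)"
      using eventually_at_right_less[of "0::real"] by eventually_elim (rule est)
  qed auto
qed

text \<open>The commutator of the transform with multiplication by a Lipschitz function has no singularity.\<close>
lemma fht_modulated:
  fixes s \<psi> :: "real \<Rightarrow> real"
  assumes s[measurable]: "s \<in> borel_measurable lebesgue" and sb: "\<And>t. \<bar>s t\<bar> \<le> c"
    and psi[measurable]: "\<psi> \<in> borel_measurable lebesgue"
    and lip: "\<And>t. \<bar>\<psi> t - \<psi> x\<bar> \<le> K * \<bar>t - x\<bar>"
    and L: "((\<lambda>e. LINT t:trunc_dom x e|lebesgue. s t / (t - x)) \<longlongrightarrow> L) (at_right 0)"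
  shows "fht (\<lambda>t. complex_of_real (s t * \<psi> t)) x
    = complex_of_real (1 / pi * (\<psi> x * L + (LINT t:{-1<..<1}|lebesgue. s t * ((\<psi> t - \<psi> x) / (t - x)))))"
proof -
  note borel_measurable_lebesgue_ident[measurable]
  let ?h = "\<lambda>t. s t * ((\<psi> t - \<psi> x) / (t - x))"
  have hm: "?h \<in> borel_measurable lebesgue" by measurable
  have K: "0 \<le> K" using lip[of "x + 1"] by simp
  have hb: "\<bar>?h t\<bar> \<le> c * K" for t
  proof -
    have "\<bar>(\<psi> t - \<psi> x) / (t - x)\<bar> \<le> K"
      using lip[of t] K by (cases "t = x") (auto simp: abs_divide divide_simps)
    thus ?thesis unfolding abs_mult using sb[of t] K by (intro mult_mono) auto
  qed
  have eq: "(LINT t:trunc_dom x e|lebesgue. complex_of_real (s t * \<psi> t) / complex_of_real (t - x))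
      = complex_of_real (\<psi> x * (LINT t:trunc_dom x e|lebesgue. s t / (t - x)) + (LINT t:trunc_dom x e|lebesgue. ?h t))"
    if e: "e > 0" for e
  proof -
    have i1: "set_integrable lebesgue (trunc_dom x e) (\<lambda>t. s t / (t - x))"
    proof (rule set_integrable_bounded_I11[where c="c / e"])
      show "\<bar>s t / (t - x)\<bar> \<le> c / e" if "t \<in> trunc_dom x e" for t
      proof -
        have "e \<le> \<bar>t - x\<bar>" using that by (auto simp: abs_if)
        thus ?thesis unfolding abs_divide using e sb[of t] by (intro frac_le) auto
      qed
    qed auto
    have i2: "set_integrable lebesgue (trunc_dom x e) ?h"
      by (rule set_integrable_bounded_I11[OF hm _ _ hb]) auto
    have "(LINT t:trunc_dom x e|lebesgue. complex_of_real (s t * \<psi> t) / complex_of_real (t - x))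
        = (LINT t:trunc_dom x e|lebesgue. complex_of_real (s t * \<psi> t / (t - x)))" by simp
    also have "\<dots> = complex_of_real (LINT t:trunc_dom x e|lebesgue. s t * \<psi> t / (t - x))"
      by (rule set_integral_complex_of_real)
    also have "(LINT t:trunc_dom x e|lebesgue. s t * \<psi> t / (t - x)) = (LINT t:trunc_dom x e|lebesgue. \<psi> x * (s t / (t - x)) + ?h t)"
    proof (rule set_lebesgue_integral_cong)
      show "\<forall>t. t \<in> trunc_dom x e \<longrightarrow> s t * \<psi> t / (t - x) = \<psi> x * (s t / (t - x)) + ?h t"
        by (auto simp: algebra_simps diff_divide_distrib)
    qed auto
    also have "\<dots> = \<psi> x * (LINT t:trunc_dom x e|lebesgue. s t / (t - x)) + (LINT t:trunc_dom x e|lebesgue. ?h t)"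
      unfolding set_integral_add(2)[OF set_integrable_mult_right[OF i1] i2] by (simp only: set_integral_mult_right)
    finally show ?thesis .
  qed
  have "((\<lambda>e. complex_of_real (1 / pi) * complex_of_real (\<psi> x * (LINT t:trunc_dom x e|lebesgue. s t / (t - x)) + (LINT t:trunc_dom x e|lebesgue. ?h t)))
     \<longlongrightarrow> complex_of_real (1 / pi) * complex_of_real (\<psi> x * L + (LINT t:{-1<..<1}|lebesgue. ?h t))) (at_right 0)"
    by (intro tendsto_intros L integral_trunc_dom_tendsto[OF hm hb])
  moreover have "\<forall>\<^sub>F e in at_right 0. complex_of_real (1 / pi) * complex_of_real (\<psi> x * (LINT t:trunc_dom x e|lebesgue. s t / (t - x)) + (LINT t:trunc_dom x e|lebesgue. ?h t))
     = complex_of_real (1 / pi) * (LINT t:trunc_dom x e|lebesgue. complex_of_real (s t * \<psi> t) / complex_of_real (t - x))"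
    using eventually_at_right_less[of "0::real"] by eventually_elim (simp only: eq)
  ultimately have "((\<lambda>e. complex_of_real (1 / pi) * (LINT t:trunc_dom x e|lebesgue. complex_of_real (s t * \<psi> t) / complex_of_real (t - x)))
     \<longlongrightarrow> complex_of_real (1 / pi) * complex_of_real (\<psi> x * L + (LINT t:{-1<..<1}|lebesgue. ?h t))) (at_right 0)"
    by (rule Lim_transform_eventually)
  hence "fht (\<lambda>t. complex_of_real (s t * \<psi> t)) x = complex_of_real (1 / pi) * complex_of_real (\<psi> x * L + (LINT t:{-1<..<1}|lebesgue. ?h t))"
    unfolding fht_def by (intro tendsto_Lim) auto
  thus ?thesis by simp
qed

subsection \<open>Fejer averages\<close>

lemma abs_sin_diff_le: "\<bar>sin a - sin b\<bar> \<le> \<bar>a - b :: real\<bar>"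
proof -
  have "\<bar>sin a - sin b\<bar> = 2 * \<bar>sin ((a - b) / 2)\<bar> * \<bar>cos ((a + b) / 2)\<bar>"
    by (simp add: sin_diff_sin abs_mult)
  also have "\<dots> \<le> 2 * \<bar>(a - b) / 2\<bar> * 1"
    by (intro mult_mono mult_left_mono abs_sin_x_le_abs_x) auto
  finally show ?thesis by simp
qed

lemma abs_cos_diff_le: "\<bar>cos a - cos b\<bar> \<le> \<bar>a - b :: real\<bar>"
  using abs_sin_diff_le[of "pi/2 - a" "pi/2 - b"] by (simp add: cos_sin_eq abs_minus_commute)

text \<open>The modified conjugate Dirichlet kernel. With the last term halved it equals (1 - cos (M
  u)) cot (u/2) / 2; the plain sum has cos (u/2) - cos ((M + 1/2) u) in place of a nonnegative
  factor and can be negative for u > 0.\<close>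

definition fejer_sine :: "nat \<Rightarrow> real \<Rightarrow> real" where
  "fejer_sine M u = (\<Sum>j<Suc M. (if j = M then 1/2 else 1) * sin (real j * u))"

lemma fejer_sine_alt: "fejer_sine M u = (\<Sum>j<M. sin (real j * u)) + sin (real M * u) / 2"
proof -
  have "(\<Sum>j<M. (if j = M then 1/2 else 1) * sin (real j * u)) = (\<Sum>j<M. sin (real j * u))"
    by (rule sum.cong) auto
  thus ?thesis by (simp add: fejer_sine_def)
qed

text \<open>Kept free of division, so that zeros of sin (u/2) need no separate case. Halving the
  last term turns each increment into the mean of two consecutive sines, and the sum-to-product
  formulas telescope.\<close>

lemma fejer_sine_closed: "2 * sin (u / 2) * fejer_sine M u = cos (u / 2) * (1 - cos (real M * u))"
proof (induction M)
  case 0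
  show ?case by (simp add: fejer_sine_alt)
next
  case (Suc M)
  let ?a = "real M * u"
  have a: "real (Suc M) * u = ?a + u" by (simp add: algebra_simps)
  have step: "fejer_sine (Suc M) u = fejer_sine M u + (sin ?a + sin (?a + u)) / 2"
  proof -
    have "S + p + q / 2 = S + p / 2 + (p + q) / 2" for S p q :: real by (simp add: field_simps)
    thus ?thesis unfolding fejer_sine_alt sum.lessThan_Suc a .
  qed
  have "2 * sin (u / 2) * fejer_sine (Suc M) u
    = cos (u / 2) * (1 - cos ?a) + sin (u / 2) * (sin ?a + sin (?a + u))"
  proof -
    have "2 * p * (f + q / 2) = 2 * p * f + p * q" for p f q :: real by (simp add: field_simps)
    thus ?thesis unfolding step Suc[symmetric] .
  qed
  also have "sin ?a + sin (?a + u) = 2 * sin (?a + u / 2) * cos (u / 2)"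
  proof -
    have m: "(?a + (?a + u)) / 2 = ?a + u / 2" "(?a - (?a + u)) / 2 = - (u / 2)" by (simp_all add: add_divide_distrib)
    show ?thesis unfolding sin_plus_sin m cos_minus ..
  qed
  also have "cos (u / 2) * (1 - cos ?a) + sin (u / 2) * (2 * sin (?a + u / 2) * cos (u / 2))
    = cos (u / 2) * (1 - (cos ?a - 2 * sin (?a + u / 2) * sin (u / 2)))" by (simp add: algebra_simps)
  also have "cos ?a - 2 * sin (?a + u / 2) * sin (u / 2) = cos (?a + u)"
    using cos_diff_cos[of ?a "?a + u"] by (simp add: add_divide_distrib mult.commute[of u])
  finally show ?case by (simp add: algebra_simps)
qed

text \<open>As |u/2| < 1 < pi/2, the cosine in the closed form is nonnegative and sin (u/2) has the
  sign of u. The 2 is the length of (-1,1), so every difference t - x of its points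
  qualifies.\<close>

lemma fejer_sine_nonneg:
  assumes "\<bar>u\<bar> < 2"
  shows "0 \<le> fejer_sine M u / u"
proof (cases "u = 0")
  case False
  have c: "0 \<le> cos (u / 2) * (1 - cos (real M * u))"
    using assms pi_gt3 by (intro mult_nonneg_nonneg cos_ge_zero) auto
  show ?thesis
  proof (cases "u > 0")
    case True
    have "sin (u / 2) > 0" using assms True pi_gt3 by (intro sin_gt_zero) auto
    hence "0 \<le> fejer_sine M u" using c fejer_sine_closed[of u M] by (metis mult_pos_pos zero_less_numeral zero_le_mult_iff not_less)
    thus ?thesis using True by simp
  next
    case F: False
    have "sin (- u / 2) > 0" using assms F False pi_gt3 by (intro sin_gt_zero) auto
    hence "2 * sin (u / 2) < 0" by simp
    hence "fejer_sine M u \<le> 0" using c fejer_sine_closed[of u M] by (metis zero_le_mult_iff not_less)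
    thus ?thesis using F False by (simp add: divide_nonpos_neg)
  qed
qed simp

lemma sin_ge_half:
  assumes "0 \<le> v" "v \<le> 1"
  shows "v / 2 \<le> sin (v::real)"
proof -
  have "\<exists>z. 0 < z \<and> z < v \<and> sin v - sin 0 = (v - 0) * cos z" if "v > 0"
    using that by (intro MVT2) (auto intro!: derivative_eq_intros)
  moreover have "cos z \<ge> 1 / 2" if "0 < z" "z < v" for z
  proof -
    have "cos z \<ge> cos (pi / 3)" using that assms pi_gt3 by (intro cos_monotone_0_pi_le) auto
    thus ?thesis by (simp add: cos_60)
  qed
  ultimately show ?thesis using assms mult_left_mono[of "1/2" _ v] by (cases "v = 0") force+
qed

text \<open>All phases j u with j \<le> M are at most 1, so each sine is at least half its argument.
  With the last term halved, the sum of these halves is exactly M^2 u / 4.\<close>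

lemma fejer_sine_lower:
  assumes "0 < u" "u \<le> 1 / real M" "0 < M"
  shows "(real M)\<^sup>2 / 4 \<le> fejer_sine M u / u"
proof -
  have s: "real j * u / 2 \<le> sin (real j * u)" if "j \<le> M" for j
  proof (rule sin_ge_half)
    have "real j * u \<le> real M * (1 / real M)" using assms that by (intro mult_mono) auto
    thus "real j * u \<le> 1" using assms by simp
  qed (use assms in simp)
  have "(\<Sum>j<M. real j * u / 2) + (real M * u / 2) / 2 \<le> fejer_sine M u"
    unfolding fejer_sine_alt by (intro add_mono sum_mono divide_right_mono s) auto
  moreover have eq: "(\<Sum>j<n. real j * u / 2) + (real n * u / 2) / 2 = (real n)\<^sup>2 / 4 * u" for n
    by (induction n) (auto simp: power2_eq_square field_simps)
  ultimately have "(real M)\<^sup>2 / 4 * u \<le> fejer_sine M u" by (simp only: eq)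
  thus ?thesis using assms by (simp add: pos_le_divide_eq)
qed

text \<open>Nonnegativity allows discarding everything outside the window [x, x + 1/M]; there the
  kernel is large and one-sided Lebesgue differentiation controls the mean of \<open>s\<close>. The
  threshold M0 depends on x, since the differentiation is not uniform.\<close>

lemma fejer_average_lower:
  fixes s :: "real \<Rightarrow> real"
  assumes s[measurable]: "s \<in> borel_measurable lebesgue" and s0: "\<And>t. 0 \<le> s t" and sb: "\<And>t. s t \<le> c"
  shows "\<exists>N. negligible N \<and> (\<forall>x\<in>{-1<..<1} - N. \<exists>M0. \<forall>M\<ge>M0. 0 < M \<longrightarrow>
     s x / (8 * pi) \<le> 1 / (pi * real M) * (LINT t:{-1<..<1}|lebesgue. s t * (fejer_sine M (t - x) / (t - x))))"
proof -
  note borel_measurable_lebesgue_ident[measurable]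
  let ?D = "{-1<..<1::real}"
  let ?I = "\<lambda>M x. LINT t:?D|lebesgue. s t * (fejer_sine M (t - x) / (t - x))"
  have int: "s absolutely_integrable_on {a..b}" for a b
    using s0 sb by (intro set_integrable_bounded[where c=c]) (auto simp: emeasure_lborel_Icc_eq)
  obtain N where N: "negligible N"
    "\<And>x e. x \<notin> N \<Longrightarrow> 0 < e \<Longrightarrow> \<exists>d>0. \<forall>h. 0 < h \<and> h < d \<longrightarrow> \<bar>integral {x..x + h} s / h - s x\<bar> < e"
  proof (rule integrable_ccontinuous_explicit[of s])
    show "s integrable_on cbox a b" for a b
      using int by (simp add: set_lebesgue_integral_eq_integral(1))
  qed (use that in \<open>auto simp: divide_inverse mult.commute\<close>)
  have k0: "0 \<le> indicator ?D t *\<^sub>R (s t * (fejer_sine M (t - x) / (t - x)))" if "x \<in> ?D - N" for M t x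
  proof (cases "t \<in> ?D")
    case True
    hence "0 \<le> s t * (fejer_sine M (t - x) / (t - x))"
      using that by (intro mult_nonneg_nonneg s0 fejer_sine_nonneg) auto
    thus ?thesis using True by (simp only: indicator_simps scaleR_one)
  qed simp
  have "\<exists>M0. \<forall>M\<ge>M0. 0 < M \<longrightarrow> s x / (8 * pi) \<le> 1 / (pi * real M) * ?I M x" if x: "x \<in> ?D - N" for x
  proof (cases "s x = 0")
    case True
    have "0 \<le> ?I M x" for M unfolding set_lebesgue_integral_def by (rule Bochner_Integration.integral_nonneg) (rule k0[OF x])
    thus ?thesis using True by simp
  next
    case False
    hence sx: "0 < s x / 2" using s0[of x] by simp
    obtain d where d: "d > 0" "\<And>h. 0 < h \<Longrightarrow> h < d \<Longrightarrow> \<bar>integral {x..x + h} s / h - s x\<bar> < s x / 2"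
      using N(2)[OF _ sx, of x] x by blast
    \<comment> \<open>Windows shorter than r lie both within the differentiation scale at x and
      inside (-1,1).\<close>
    define r where "r = min d (1 - x)"
    have r: "r > 0" "r \<le> d" "r \<le> 1 - x" using d x unfolding r_def by auto
    obtain n where n: "1 / real (Suc n) < r" using nat_approx_posE[OF r(1)] by blast
    have "s x / (8 * pi) \<le> 1 / (pi * real M) * ?I M x" if M: "M \<ge> Suc n" for M
    proof -
      let ?h = "1 / real M"
      have h: "0 < ?h" "?h < r"
      proof -
        have "?h \<le> 1 / real (Suc n)" using M by (intro divide_left_mono) auto
        thus "?h < r" using n by linarith
      qed (use M in simp)
      have "integral {x..x + ?h} s / ?h > s x / 2" using d(2)[of ?h] h r by linarith
      hence i: "s x / 2 * ?h \<le> integral {x..x + ?h} s" using h(1) by (simp add: field_simps)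
      \<comment> \<open>A crude bound, growing with M, that serves only to make the integrand
        integrable.\<close>
      have "\<bar>fejer_sine M u / u\<bar> \<le> (real (Suc M)) * real M" for u
      proof -
        have "\<bar>fejer_sine M u\<bar> \<le> (\<Sum>j<Suc M. \<bar>(if j = M then 1/2 else 1) * sin (real j * u)\<bar>)"
          unfolding fejer_sine_def by (rule sum_abs)
        also have "\<dots> \<le> (\<Sum>j<Suc M. real M * \<bar>u\<bar>)"
        proof (rule sum_mono)
          fix j assume j: "j \<in> {..<Suc M}"
          have "\<bar>(if j = M then 1/2 else 1) * sin (real j * u)\<bar> \<le> \<bar>sin (real j * u)\<bar>" by auto
          also have "\<dots> \<le> \<bar>real j * u\<bar>" by (rule abs_sin_x_le_abs_x)
          also have "\<dots> \<le> real M * \<bar>u\<bar>" using j by (auto simp: abs_mult intro!: mult_right_mono)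
          finally show "\<bar>(if j = M then 1/2 else 1) * sin (real j * u)\<bar> \<le> real M * \<bar>u\<bar>" .
        qed
        also have "\<dots> = (real (Suc M) * real M) * \<bar>u\<bar>" by simp
        finally show ?thesis by (cases "u = 0") (auto simp: abs_divide divide_simps)
      qed
      hence bd: "\<bar>s t * (fejer_sine M (t - x) / (t - x))\<bar> \<le> c * (real (Suc M) * real M)" for t
        unfolding abs_mult using s0[of t] sb[of t] by (intro mult_mono) auto
      have "(real M)\<^sup>2 / 4 * (s x / 2 * ?h) \<le> (real M)\<^sup>2 / 4 * integral {x..x + ?h} s"
        using i by (rule mult_left_mono) simp
      also have "integral {x..x + ?h} s = (LINT t:{x..x + ?h}|lebesgue. s t)"
        using int by (simp add: set_lebesgue_integral_eq_integral(2))
      also have "(real M)\<^sup>2 / 4 * (LINT t:{x..x + ?h}|lebesgue. s t) = (LINT t:{x..x + ?h}|lebesgue. (real M)\<^sup>2 / 4 * s t)"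
        by (simp only: set_integral_mult_right)
      also have "\<dots> \<le> ?I M x" unfolding set_lebesgue_integral_def
      proof (rule integral_mono_AE)
        have "set_integrable lebesgue {x..x + ?h} (\<lambda>t. (real M)\<^sup>2 / 4 * s t)"
          by (intro set_integrable_mult_right int)
        thus "integrable lebesgue (\<lambda>t. indicator {x..x + ?h} t *\<^sub>R ((real M)\<^sup>2 / 4 * s t))"
          unfolding set_integrable_def .
        show "integrable lebesgue (\<lambda>t. indicator ?D t *\<^sub>R (s t * (fejer_sine M (t - x) / (t - x))))"
          using set_integrable_bounded_I11[of "\<lambda>t. s t * (fejer_sine M (t - x) / (t - x))" ?D] bd
          unfolding set_integrable_def fejer_sine_def by auto
        have "AE t in lebesgue. t \<noteq> x" using AE_lborel_singleton by (rule AE_completion)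
        thus "AE t in lebesgue. indicator {x..x + ?h} t *\<^sub>R ((real M)\<^sup>2 / 4 * s t)
            \<le> indicator ?D t *\<^sub>R (s t * (fejer_sine M (t - x) / (t - x)))"
        proof eventually_elim
          case (elim t)
          show ?case
          proof (cases "t \<in> {x..x + ?h}")
            case True
            have "(real M)\<^sup>2 / 4 \<le> fejer_sine M (t - x) / (t - x)"
              using True elim M by (intro fejer_sine_lower) auto
            hence "s t * ((real M)\<^sup>2 / 4) \<le> s t * (fejer_sine M (t - x) / (t - x))" using s0 by (intro mult_left_mono)
            moreover have "t \<in> ?D" using True x h r by auto
            ultimately show ?thesis using True by (simp add: mult.commute)
          next
            case False
            thus ?thesis using k0[OF x, of t M] by simp
          qed
        qed
      qed
      finally have "real M * s x / 8 \<le> ?I M x" using M by (simp add: power2_eq_square)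
      hence "1 / (pi * real M) * (real M * s x / 8) \<le> 1 / (pi * real M) * ?I M x" by (intro mult_left_mono) auto
      moreover have "1 / (pi * real M) * (real M * s x / 8) = s x / (8 * pi)" using M by simp
      ultimately show ?thesis by (simp only:)
    qed
    thus ?thesis by blast
  qed
  thus ?thesis using N(1) by blast
qed

subsection \<open>The norm estimate\<close>

lemma space_I11: "space I11 = {-1<..<1}"
  by (simp add: I11_def space_restrict_space)

lemma borel_measurable_I11: "f \<in> borel_measurable lebesgue \<Longrightarrow> f \<in> borel_measurable I11"
  unfolding I11_def by (rule measurable_restrict_space1)

lemma AE_I11_negligible:
  assumes "negligible N" "\<And>x. x \<in> {-1<..<1} - N \<Longrightarrow> P x"
  shows "AE x in I11. P x"
proof -
  have "AE x in lebesgue. x \<notin> N" using assms(1) by (intro AE_not_in) (simp add: negligible_iff_null_sets)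
  hence "AE x in lebesgue. x \<in> {-1<..<1} \<longrightarrow> P x" by eventually_elim (use assms(2) in auto)
  thus ?thesis unfolding I11_def by (subst AE_restrict_space_iff) auto
qed

lemma
  assumes "is_bfs \<rho>"
  shows bfs_mono: "\<lbrakk>f \<in> borel_measurable I11; g \<in> borel_measurable I11; AE x in I11. cmod (g x) \<le> cmod (f x)\<rbrakk> \<Longrightarrow> \<rho> g \<le> \<rho> f"
    and bfs_triangle: "\<lbrakk>f \<in> borel_measurable I11; g \<in> borel_measurable I11\<rbrakk> \<Longrightarrow> \<rho> (\<lambda>x. f x + g x) \<le> \<rho> f + \<rho> g"
    and bfs_scale: "f \<in> borel_measurable I11 \<Longrightarrow> \<rho> (\<lambda>x. c * f x) = ennreal (cmod c) * \<rho> f"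
    and bfs_Fatou: "\<lbrakk>\<And>n. F n \<in> borel_measurable I11; f \<in> borel_measurable I11;
        AE x in I11. incseq (\<lambda>n. cmod (F n x)) \<and> (\<lambda>n. cmod (F n x)) \<longlonglongrightarrow> cmod (f x)\<rbrakk> \<Longrightarrow> \<rho> f = (SUP n. \<rho> (F n))"
    and bfs_AE_zero: "\<lbrakk>f \<in> borel_measurable I11; AE x in I11. f x = 0\<rbrakk> \<Longrightarrow> \<rho> f = 0"
  using assms unfolding is_bfs_def by blast+

lemma bfs_sum_le:
  assumes \<rho>: "is_bfs \<rho>" and F: "\<And>j. j < n \<Longrightarrow> F j \<in> borel_measurable I11" "\<And>j. j < n \<Longrightarrow> \<rho> (F j) \<le> K"
  shows "\<rho> (\<lambda>x. \<Sum>j<n. F j x) \<le> of_nat n * K"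
  using F
proof (induction n)
  case 0
  show ?case using bfs_AE_zero[OF \<rho>, of "\<lambda>_. 0"] by simp
next
  case (Suc n)
  have [measurable]: "F j \<in> borel_measurable I11" if "j \<in> {..<n}" for j using Suc(2) that by simp
  have "\<rho> (\<lambda>x. (\<Sum>j<n. F j x) + F n x) \<le> \<rho> (\<lambda>x. \<Sum>j<n. F j x) + \<rho> (F n)"
    using Suc(2) by (intro bfs_triangle[OF \<rho>] borel_measurable_sum) auto
  also have "\<dots> \<le> of_nat n * K + K" using Suc by (intro add_mono) auto
  finally show ?case by (simp add: distrib_right add.commute)
qed

text \<open>The constant depends neither on M nor on the supremum of \<open>s\<close>. Each
  frequency contributes two transforms of norm at most Q, and M + 1 frequencies divided by M cost at
  most another factor 2, whence 4 Q; the factor \<open>8 * pi\<close> undoes the pointwise lower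
  bound.\<close>

lemma simple_function_norm_le:
  fixes s :: "real \<Rightarrow> real"
  assumes X: "is_bfs \<rho>X" and Z: "is_bfs \<rho>Z"
    and T: "\<And>f. f \<in> bfs_space \<rho>Z \<Longrightarrow> fht f \<in> bfs_space \<rho>X \<and> \<rho>X (fht f) \<le> ennreal C * \<rho>Z f"
    and s: "simple_function lebesgue s" "\<And>t. 0 \<le> s t"
    and sZ: "(\<lambda>x. complex_of_real (s x)) \<in> bfs_space \<rho>Z"
  shows "\<rho>X (\<lambda>x. complex_of_real (s x)) \<le> ennreal (8 * pi) * (4 * (ennreal C * \<rho>Z (\<lambda>x. complex_of_real (s x))))"
proof -
  let ?D = "{-1<..<1::real}"
  have sm[measurable]: "s \<in> borel_measurable lebesgue" using s(1) by (rule borel_measurable_simple_function)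
  obtain c where c: "\<And>t. s t \<le> c"
  proof -
    have "finite (range s)" using simple_functionD(1)[OF s(1)] by simp
    thus ?thesis using that[of "Max (range s)"] by (auto intro: Max_ge)
  qed
  have sb: "\<bar>s t\<bar> \<le> c" for t using s(2)[of t] c[of t] by simp
  define Q where "Q = ennreal C * \<rho>Z (\<lambda>x. complex_of_real (s x))"
  define gs where "gs j = (\<lambda>t. complex_of_real (s t * sin (real j * t)))" for j
  define gc where "gc j = (\<lambda>t. complex_of_real (s t * cos (real j * t)))" for j
  have g_bound: "fht g \<in> borel_measurable I11 \<and> \<rho>X (fht g) \<le> Q"
    if g: "g = (\<lambda>t. complex_of_real (s t * \<psi> t))" and psi[measurable]: "\<psi> \<in> borel_measurable lebesgue" and le: "\<And>t. \<bar>\<psi> t\<bar> \<le> 1" for g \<psi>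
  proof -
    have gm: "g \<in> borel_measurable I11" unfolding g by (rule borel_measurable_I11) measurable
    have "\<rho>Z g \<le> \<rho>Z (\<lambda>x. complex_of_real (s x))"
    proof (rule bfs_mono[OF Z])
      have "cmod (g x) \<le> cmod (complex_of_real (s x))" for x
        using mult_left_mono[OF le[of x], of "\<bar>s x\<bar>"] by (simp add: g norm_mult del: of_real_mult) (simp add: abs_mult)
      thus "AE x in I11. cmod (g x) \<le> cmod (complex_of_real (s x))" by simp
    qed (use gm sZ in \<open>auto simp: bfs_space_def\<close>)
    moreover from this have "g \<in> bfs_space \<rho>Z" using gm sZ unfolding bfs_space_def by (auto intro: le_less_trans)
    ultimately show ?thesis using T[of g] unfolding Q_def bfs_space_def
      by (auto intro: order_trans[OF _ mult_left_mono])
  qed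
  have mt: "(\<lambda>t. sin (real j * t)) \<in> borel_measurable lebesgue" "(\<lambda>t. cos (real j * t)) \<in> borel_measurable lebesgue" for j
    by (rule measurable_completion, measurable)+
  have gs: "fht (gs j) \<in> borel_measurable I11" "\<rho>X (fht (gs j)) \<le> Q" for j
    using g_bound[of "gs j" "\<lambda>t. sin (real j * t)"] mt(1)[of j] by (auto simp: gs_def)
  have gc: "fht (gc j) \<in> borel_measurable I11" "\<rho>X (fht (gc j)) \<le> Q" for j
    using g_bound[of "gc j" "\<lambda>t. cos (real j * t)"] mt(2)[of j] by (auto simp: gc_def)
  have unimod: "(\<lambda>x. complex_of_real (\<psi> x) * F x) \<in> borel_measurable I11 \<and> \<rho>X (\<lambda>x. complex_of_real (\<psi> x) * F x) \<le> K"
    if "F \<in> borel_measurable I11" "\<rho>X F \<le> K" "\<psi> \<in> borel_measurable lebesgue" "\<And>x. \<bar>\<psi> x\<bar> \<le> 1" for F \<psi> K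
  proof
    have [measurable]: "(\<lambda>x. complex_of_real (\<psi> x)) \<in> borel_measurable I11" "F \<in> borel_measurable I11"
      using that by (auto intro!: borel_measurable_I11)
    show m: "(\<lambda>x. complex_of_real (\<psi> x) * F x) \<in> borel_measurable I11" by measurable
    have "\<rho>X (\<lambda>x. complex_of_real (\<psi> x) * F x) \<le> \<rho>X F"
      by (rule bfs_mono[OF X that(1) m]) (use that(4) in \<open>auto simp: norm_mult intro!: mult_left_le_one_le\<close>)
    thus "\<rho>X (\<lambda>x. complex_of_real (\<psi> x) * F x) \<le> K" using that(2) by (rule order_trans)
  qed
  define A where "A j x = complex_of_real (cos (real j * x)) * fht (gs j) x + complex_of_real (- sin (real j * x)) * fht (gc j) x" for j x
  have A: "A j \<in> borel_measurable I11" "\<rho>X (A j) \<le> 2 * Q" for j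
  proof -
    note u = unimod[OF gs[of j], OF mt(2)[of j]] unimod[OF gc[of j], of "\<lambda>x. - sin (real j * x)", OF borel_measurable_uminus[OF mt(1)[of j]]]
    have 1: "(\<lambda>x. complex_of_real (cos (real j * x)) * fht (gs j) x) \<in> borel_measurable I11"
      "\<rho>X (\<lambda>x. complex_of_real (cos (real j * x)) * fht (gs j) x) \<le> Q"
      using u(1) by auto
    have 2: "(\<lambda>x. complex_of_real (- sin (real j * x)) * fht (gc j) x) \<in> borel_measurable I11"
      "\<rho>X (\<lambda>x. complex_of_real (- sin (real j * x)) * fht (gc j) x) \<le> Q"
      using u(2) by auto
    show "A j \<in> borel_measurable I11" unfolding A_def[abs_def] using 1(1) 2(1) by (rule borel_measurable_add)
    have "\<rho>X (A j) \<le> \<rho>X (\<lambda>x. complex_of_real (cos (real j * x)) * fht (gs j) x) + \<rho>X (\<lambda>x. complex_of_real (- sin (real j * x)) * fht (gc j) x)"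
      unfolding A_def[abs_def] by (rule bfs_triangle[OF X 1(1) 2(1)])
    also have "\<dots> \<le> Q + Q" using 1(2) 2(2) by (rule add_mono)
    finally show "\<rho>X (A j) \<le> 2 * Q" by (simp add: mult_2)
  qed
  define W :: "nat \<Rightarrow> nat \<Rightarrow> real" where "W M j = (if j = M then 1/2 else 1)" for M j
  define B where "B M x = complex_of_real (1 / real M) * (\<Sum>j<Suc M. complex_of_real (W M j) * A j x)" for M x
  have W1: "\<bar>W M j\<bar> \<le> 1" for M j by (simp add: W_def)
  have WA: "(\<lambda>x. complex_of_real (W M j) * A j x) \<in> borel_measurable I11" "\<rho>X (\<lambda>x. complex_of_real (W M j) * A j x) \<le> 2 * Q" for M j
    using unimod[OF A[of j], of "\<lambda>_. W M j", OF borel_measurable_const W1] by blast+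
  have SA: "(\<lambda>x. \<Sum>j<Suc M. complex_of_real (W M j) * A j x) \<in> borel_measurable I11" for M
    by (rule borel_measurable_sum) (rule WA)
  have Bm[measurable]: "B M \<in> borel_measurable I11" for M
    unfolding B_def[abs_def] by (rule borel_measurable_times[OF borel_measurable_const SA])
  have BQ: "\<rho>X (B M) \<le> 4 * Q" if "M > 0" for M
  proof -
    have "\<rho>X (B M) = ennreal (1 / real M) * \<rho>X (\<lambda>x. \<Sum>j<Suc M. complex_of_real (W M j) * A j x)"
    proof -
      have n: "cmod (complex_of_real (1 / real M)) = 1 / real M" by (simp only: norm_of_real) simp
      show ?thesis unfolding B_def[abs_def] bfs_scale[OF X SA] n ..
    qed
    also have "\<dots> \<le> ennreal (1 / real M) * (of_nat (Suc M) * (2 * Q))"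
      by (intro mult_left_mono bfs_sum_le[OF X] WA) auto
    also have "\<dots> = ennreal (1 / real M * real (Suc M)) * (2 * Q)"
    proof -
      have "ennreal (1 / real M * real (Suc M)) = ennreal (1 / real M) * of_nat (Suc M)"
        unfolding ennreal_of_nat_eq_real_of_nat by (rule ennreal_mult) auto
      thus ?thesis by (simp only: mult.assoc)
    qed
    also have "\<dots> \<le> ennreal 2 * (2 * Q)"
      using that by (intro mult_right_mono ennreal_leI) (auto simp: field_simps)
    also have "\<dots> = 4 * Q" by (simp add: mult.assoc[symmetric])
    finally show ?thesis .
  qed
  obtain N1 where N1: "negligible N1"
    "\<And>x. x \<in> ?D - N1 \<Longrightarrow> \<exists>L. ((\<lambda>e. LINT t:trunc_dom x e|lebesgue. s t / (t - x)) \<longlongrightarrow> L) (at_right 0)"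
    using truncated_hilbert_limit_simple[OF s(1)] by blast
  obtain N2 where N2: "negligible N2"
    "\<And>x. x \<in> ?D - N2 \<Longrightarrow> \<exists>M0. \<forall>M\<ge>M0. 0 < M \<longrightarrow>
     s x / (8 * pi) \<le> 1 / (pi * real M) * (LINT t:?D|lebesgue. s t * (fejer_sine M (t - x) / (t - x)))"
    using fejer_average_lower[OF sm s(2) c] by blast
  let ?h = "\<lambda>j x t. s t * (sin (real j * (t - x)) / (t - x))"
  have kb: "\<bar>s t * ((\<phi> t - \<phi> x) / (t - x))\<bar> \<le> c * K" if "\<bar>\<phi> t - \<phi> x\<bar> \<le> K * \<bar>t - x\<bar>" "0 \<le> K" for \<phi> :: "real \<Rightarrow> real" and t x K
  proof -
    have "\<bar>(\<phi> t - \<phi> x) / (t - x)\<bar> \<le> K" using that by (cases "t = x") (auto simp: abs_divide divide_simps)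
    thus ?thesis unfolding abs_mult using sb[of t] that by (intro mult_mono) auto
  qed
  have A_eq: "A j x = complex_of_real (1 / pi * (LINT t:?D|lebesgue. ?h j x t))" if x: "x \<in> ?D - N1" for j x
  proof -
    note borel_measurable_lebesgue_ident[measurable]
    obtain L where L: "((\<lambda>e. LINT t:trunc_dom x e|lebesgue. s t / (t - x)) \<longlongrightarrow> L) (at_right 0)" using N1(2)[OF x] by blast
    let ?s = "\<lambda>t. sin (real j * t)" and ?c = "\<lambda>t. cos (real j * t)"
    have ls: "\<bar>?s t - ?s x\<bar> \<le> real j * \<bar>t - x\<bar>" and lc: "\<bar>?c t - ?c x\<bar> \<le> real j * \<bar>t - x\<bar>" for t
      using abs_sin_diff_le[of "real j * t" "real j * x"] abs_cos_diff_le[of "real j * t" "real j * x"]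
      by (simp_all add: right_diff_distrib[symmetric] abs_mult)
    let ?hs = "\<lambda>t. s t * ((?s t - ?s x) / (t - x))" and ?hc = "\<lambda>t. s t * ((?c t - ?c x) / (t - x))"
    note mt[measurable]
    have "?hs \<in> borel_measurable lebesgue" "?hc \<in> borel_measurable lebesgue" by measurable
    hence i_s: "set_integrable lebesgue ?D ?hs" and i_c: "set_integrable lebesgue ?D ?hc"
      by (auto intro!: set_integrable_bounded_I11 kb ls lc simp del: times_divide_eq_right)
    have S: "fht (gs j) x = complex_of_real (1 / pi * (?s x * L + (LINT t:?D|lebesgue. ?hs t)))"
      unfolding gs_def by (rule fht_modulated[OF sm sb mt(1) ls L])
    have C: "fht (gc j) x = complex_of_real (1 / pi * (?c x * L + (LINT t:?D|lebesgue. ?hc t)))"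
      unfolding gc_def by (rule fht_modulated[OF sm sb mt(2) lc L])
    have "(LINT t:?D|lebesgue. ?h j x t) = (LINT t:?D|lebesgue. ?c x * ?hs t - ?s x * ?hc t)"
    proof (rule set_lebesgue_integral_cong)
      have "S * ((a * c - b * d) / r) = c * (S * ((a - d) / r)) - d * (S * ((b - c) / r))" for S a b c d r :: real
        by (simp add: diff_divide_distrib algebra_simps)
      thus "\<forall>t. t \<in> ?D \<longrightarrow> ?h j x t = ?c x * ?hs t - ?s x * ?hc t"
        unfolding right_diff_distrib[of "real j"] sin_diff by (intro allI impI)
    qed simp
    also have "\<dots> = ?c x * (LINT t:?D|lebesgue. ?hs t) - ?s x * (LINT t:?D|lebesgue. ?hc t)"
      unfolding set_integral_diff(2)[OF set_integrable_mult_right[OF i_s] set_integrable_mult_right[OF i_c]]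
      by (simp only: set_integral_mult_right)
    finally have e: "(LINT t:?D|lebesgue. ?h j x t) = ?c x * (LINT t:?D|lebesgue. ?hs t) - ?s x * (LINT t:?D|lebesgue. ?hc t)" .
    \<comment> \<open>The principal value L appears once with factor cos sin and once with -sin cos,
      and cancels. Only its existence is used.\<close>
    have "p * (c * I - d * J) = c * (p * (d * L + I)) + (- d) * (p * (c * L + J))" for p c d I J :: real
      by (simp add: algebra_simps)
    hence "1 / pi * (LINT t:?D|lebesgue. ?h j x t)
        = ?c x * (1 / pi * (?s x * L + (LINT t:?D|lebesgue. ?hs t))) + (- ?s x) * (1 / pi * (?c x * L + (LINT t:?D|lebesgue. ?hc t)))"
      unfolding e .
    thus ?thesis unfolding A_def S C of_real_mult[symmetric] of_real_add[symmetric] by (simp only:)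
  qed
  have B_eq: "B M x = complex_of_real (1 / (pi * real M) * (LINT t:?D|lebesgue. s t * (fejer_sine M (t - x) / (t - x))))"
    if x: "x \<in> ?D - N1" for M x
  proof -
    note borel_measurable_lebesgue_ident[measurable]
    have i: "integrable lebesgue (\<lambda>t. W M j * (indicator ?D t *\<^sub>R ?h j x t))" for j
    proof -
      have "\<bar>?h j x t\<bar> \<le> c * real j" for t
        using kb[of "\<lambda>t. sin (real j * (t - x))" t x "real j"] abs_sin_x_le_abs_x[of "real j * (t - x)"] by (simp add: abs_mult)
      hence "set_integrable lebesgue ?D (?h j x)" by (intro set_integrable_bounded_I11) auto
      thus ?thesis unfolding set_integrable_def by (rule integrable_mult_right)
    qed
    have "(\<Sum>j<Suc M. W M j * (LINT t:?D|lebesgue. ?h j x t)) = (LINT t|lebesgue. (\<Sum>j<Suc M. W M j * (indicator ?D t *\<^sub>R ?h j x t)))"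
      unfolding set_lebesgue_integral_def by (subst Bochner_Integration.integral_sum[OF i]) (simp only: integral_mult_right_zero)
    also have "\<dots> = (LINT t:?D|lebesgue. s t * (fejer_sine M (t - x) / (t - x)))"
      unfolding set_lebesgue_integral_def fejer_sine_def W_def[symmetric]
      by (rule Bochner_Integration.integral_cong)
        (auto simp: sum_distrib_left sum_divide_distrib mult_ac simp del: sum.lessThan_Suc)
    finally have e: "(\<Sum>j<Suc M. W M j * (LINT t:?D|lebesgue. ?h j x t)) = (LINT t:?D|lebesgue. s t * (fejer_sine M (t - x) / (t - x)))" .
    have "B M x = complex_of_real (1 / real M * (\<Sum>j<Suc M. W M j * (1 / pi * (LINT t:?D|lebesgue. ?h j x t))))"
      unfolding B_def A_eq[OF x] by (simp only: of_real_mult of_real_sum)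
    also have "(\<Sum>j<Suc M. W M j * (1 / pi * (LINT t:?D|lebesgue. ?h j x t))) = 1 / pi * (\<Sum>j<Suc M. W M j * (LINT t:?D|lebesgue. ?h j x t))"
      by (simp only: sum_distrib_left mult.left_commute)
    finally show ?thesis unfolding e by simp
  qed
  have low: "\<exists>M0. \<forall>M\<ge>M0. 0 < M \<longrightarrow> s x / (8 * pi) \<le> cmod (B M x)" if x: "x \<in> ?D - (N1 \<union> N2)" for x
  proof -
    have "x \<in> ?D - N1" "x \<in> ?D - N2" using x by auto
    with N2(2)[of x] show ?thesis unfolding B_eq[OF \<open>x \<in> ?D - N1\<close>] norm_of_real by (meson abs_ge_self order_trans)
  qed
  \<comment> \<open>The averages exceed s / (8 pi) only eventually, at a rate depending on x, and
    need not be monotone in M, whereas the Fatou property wants increasing moduli. Keeping s / (8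
    pi) only where the bound already holds for all later M gives an increasing sequence dominated by
    \<open>B (Suc n)\<close>; \<open>Suc\<close> keeps M positive.\<close>
  define G where "G n x = (if \<forall>M\<ge>Suc n. s x / (8 * pi) \<le> cmod (B M x) then complex_of_real (s x / (8 * pi)) else 0)" for n x
  have s': "s \<in> borel_measurable I11" using sm by (rule borel_measurable_I11)
  have Gm: "G n \<in> borel_measurable I11" for n
    unfolding G_def[abs_def] using s' by measurable
  have GB: "\<rho>X (G n) \<le> 4 * Q" for n
  proof -
    have "cmod (G n x) \<le> cmod (B (Suc n) x)" for x
      unfolding G_def using s(2)[of x] by (auto simp: norm_divide norm_mult)
    hence "\<rho>X (G n) \<le> \<rho>X (B (Suc n))" by (intro bfs_mono[OF X Bm Gm]) auto
    thus ?thesis using BQ[of "Suc n"] by simp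
  qed
  have lim: "\<rho>X (\<lambda>x. complex_of_real (s x / (8 * pi))) = (SUP n. \<rho>X (G n))"
  proof (rule bfs_Fatou[OF X Gm])
    show "(\<lambda>x. complex_of_real (s x / (8 * pi))) \<in> borel_measurable I11" using s' by measurable
    show "AE x in I11. incseq (\<lambda>n. cmod (G n x)) \<and> (\<lambda>n. cmod (G n x)) \<longlonglongrightarrow> cmod (complex_of_real (s x / (8 * pi)))"
    proof (rule AE_I11_negligible)
      show "negligible (N1 \<union> N2)" using N1(1) N2(1) by (rule negligible_Un)
      fix x assume "x \<in> ?D - (N1 \<union> N2)"
      then obtain M0 where M0: "\<And>M. M \<ge> M0 \<Longrightarrow> 0 < M \<Longrightarrow> s x / (8 * pi) \<le> cmod (B M x)" using low by blast
      have "incseq (\<lambda>n. cmod (G n x))" by (rule incseq_SucI) (auto simp: G_def)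
      moreover have ev: "\<forall>\<^sub>F n in sequentially. cmod (complex_of_real (s x / (8 * pi))) = cmod (G n x)"
        unfolding eventually_sequentially using M0 by (intro exI[of _ M0]) (auto simp: G_def)
      ultimately show "incseq (\<lambda>n. cmod (G n x)) \<and> (\<lambda>n. cmod (G n x)) \<longlonglongrightarrow> cmod (complex_of_real (s x / (8 * pi)))"
        by (intro conjI Lim_transform_eventually[OF tendsto_const ev])
    qed
  qed
  have "\<rho>X (\<lambda>x. complex_of_real (s x)) = \<rho>X (\<lambda>x. complex_of_real (8 * pi) * complex_of_real (s x / (8 * pi)))"
    unfolding of_real_mult[symmetric] by simp
  also have "\<dots> = ennreal (8 * pi) * \<rho>X (\<lambda>x. complex_of_real (s x / (8 * pi)))"
    using s' by (subst bfs_scale[OF X]) auto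
  also have "\<dots> \<le> ennreal (8 * pi) * (4 * Q)"
    unfolding lim by (intro mult_left_mono SUP_least GB) auto
  finally show ?thesis unfolding Q_def .
qed

section \<open>Passage from simple functions to the whole larger space\<close>

theorem theorem4p7:
  fixes \<rho>X :: "(real \<Rightarrow> complex) \<Rightarrow> ennreal"
  assumes "is_ri \<rho>X"
    and "(1/2 < lower_boyd \<rho>X \<and> lower_boyd \<rho>X \<le> upper_boyd \<rho>X \<and> upper_boyd \<rho>X < 1) \<or>
         (0 < lower_boyd \<rho>X \<and> lower_boyd \<rho>X \<le> upper_boyd \<rho>X \<and> upper_boyd \<rho>X < 1/2)"
  shows "\<not> (\<exists>\<rho>Z. is_bfs \<rho>Z \<and> bfs_space \<rho>X \<subset> bfs_space \<rho>Z \<and> bfs_space \<rho>Z \<subseteq> L1_space \<and>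
            (\<exists>C::real. \<forall>f \<in> bfs_space \<rho>Z.
               fht f \<in> bfs_space \<rho>X \<and> \<rho>X (fht f) \<le> ennreal C * \<rho>Z f))"
proof
  assume "\<exists>\<rho>Z. is_bfs \<rho>Z \<and> bfs_space \<rho>X \<subset> bfs_space \<rho>Z \<and> bfs_space \<rho>Z \<subseteq> L1_space \<and>
            (\<exists>C::real. \<forall>f \<in> bfs_space \<rho>Z.
               fht f \<in> bfs_space \<rho>X \<and> \<rho>X (fht f) \<le> ennreal C * \<rho>Z f)"
  then obtain \<rho>Z C where Z: "is_bfs \<rho>Z" and sub: "bfs_space \<rho>X \<subset> bfs_space \<rho>Z"
    and T: "\<And>f. f \<in> bfs_space \<rho>Z \<Longrightarrow> fht f \<in> bfs_space \<rho>X \<and> \<rho>X (fht f) \<le> ennreal C * \<rho>Z f"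
    by blast
  have X: "is_bfs \<rho>X" using assms(1) unfolding is_ri_def by blast
  have "f \<in> bfs_space \<rho>X" if f: "f \<in> bfs_space \<rho>Z" for f
  proof -
    have fm[measurable]: "f \<in> borel_measurable I11" and fZ: "\<rho>Z f < \<infinity>" using f unfolding bfs_space_def by auto
    \<comment> \<open>The modulus, extended by zero to the line, so that simple functions for
      \<open>lebesgue\<close> can approximate it.\<close>
    define g where "g x = indicator {-1<..<1} x *\<^sub>R cmod (f x)" for x :: real
    have g: "g \<in> borel_measurable lebesgue" "\<And>x. 0 \<le> g x"
    proof -
      have "(\<lambda>x. cmod (f x)) \<in> borel_measurable (restrict_space lebesgue {-1<..<1})"
        using fm unfolding I11_def by measurable
      thus "g \<in> borel_measurable lebesgue"
        unfolding g_def[abs_def] by (subst (asm) borel_measurable_restrict_space_iff) auto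
    qed (simp add: g_def)
    obtain s where s: "incseq s" "\<And>i. simple_function lebesgue (s i)" "\<And>x. bdd_above (range (\<lambda>i. s i x))"
      "\<And>i x. 0 \<le> s i x" "g = (SUP i. s i)"
      using borel_measurable_implies_simple_function_sequence_real[OF g] by blast
    have gx: "g x = (SUP i. s i x)" for x by (subst s(5)) (rule SUP_apply)
    have mono: "incseq (\<lambda>i. s i x)" for x using s(1) by (auto simp: incseq_def le_fun_def)
    have le: "s i x \<le> g x" for i x unfolding gx by (rule cSUP_upper[OF UNIV_I s(3)])
    have lim: "(\<lambda>i. s i x) \<longlonglongrightarrow> g x" for x unfolding gx by (rule LIMSEQ_incseq_SUP[OF s(3) mono])
    have sm: "(\<lambda>x. complex_of_real (s i x)) \<in> borel_measurable I11" for i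
      using borel_measurable_simple_function[OF s(2)] by (intro borel_measurable_I11) measurable
    have sZ: "\<rho>Z (\<lambda>x. complex_of_real (s i x)) \<le> \<rho>Z f" for i
    proof (rule bfs_mono[OF Z fm sm])
      have "s i x \<le> cmod (f x)" for x
        using le[of i x] unfolding g_def by (auto simp: indicator_def split: if_splits intro: order_trans)
      thus "AE x in I11. cmod (complex_of_real (s i x)) \<le> cmod (f x)" using s(4) by auto
    qed
    have sX: "\<rho>X (\<lambda>x. complex_of_real (s i x)) \<le> ennreal (8 * pi) * (4 * (ennreal C * \<rho>Z f))" for i
    proof -
      have "(\<lambda>x. complex_of_real (s i x)) \<in> bfs_space \<rho>Z"
        using sm sZ[of i] fZ unfolding bfs_space_def by (auto intro: le_less_trans)
      from simple_function_norm_le[OF X Z T s(2,4) this]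
      have "\<rho>X (\<lambda>x. complex_of_real (s i x)) \<le> ennreal (8 * pi) * (4 * (ennreal C * \<rho>Z (\<lambda>x. complex_of_real (s i x))))" .
      also have "\<dots> \<le> ennreal (8 * pi) * (4 * (ennreal C * \<rho>Z f))" by (intro mult_left_mono sZ) auto
      finally show ?thesis .
    qed
    \<comment> \<open>The Fatou property compares moduli only, so simple functions increasing to |f|
      determine the norm of the complex function f itself.\<close>
    have "\<rho>X f = (SUP i. \<rho>X (\<lambda>x. complex_of_real (s i x)))"
    proof (rule bfs_Fatou[OF X sm fm])
      have "g x = cmod (f x)" if "x \<in> {-1<..<1}" for x using that by (simp add: g_def)
      thus "AE x in I11. incseq (\<lambda>i. cmod (complex_of_real (s i x))) \<and> (\<lambda>i. cmod (complex_of_real (s i x))) \<longlonglongrightarrow> cmod (f x)"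
        using mono lim s(4) by (intro AE_I2) (metis (no_types, lifting) space_I11 norm_of_real abs_of_nonneg ext)
    qed
    also have "\<dots> \<le> ennreal (8 * pi) * (4 * (ennreal C * \<rho>Z f))" by (intro SUP_least sX)
    also have "\<dots> < \<infinity>" using fZ by (simp add: ennreal_mult_less_top)
    finally show ?thesis unfolding bfs_space_def using fm by auto
  qed
  thus False using sub by blast
qed

end
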